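(* Let $d\in\mathbb N$, $\mathcal A\subseteq\mathbb R$, $\Omega:=\mathcal A^{\mathbb Z^d}$ and let $(\Omega,\mathcal B(\Omega),\mathbb P)$ be a probability space such that $\mathbb P$ satisfies the properties (M1), (M2), (M3) (listed in the context) with correlation length $r\in\mathbb N_0$. Let $f\colon\mathcal F\times\Omega\to\mathbb B$ be an admissible function, and let $\Lambda_n:=[0,n)^d\cap\mathbb Z^d$ for $n\in\mathbb N$. Then there exist a set $\tilde\Omega\in\mathcal B(\Omega)$ with $\mathbb P(\tilde\Omega)=1$ and a function $f^*\in\mathbb B$ such that for every $\omega\in\tilde\Omega$ $$\lim_{n\to\infty}\Bigl\lVert\frac{f(\Lambda_n,\omega)}{|\Lambda_n|}-f^*\Bigr\rVert=0 .$$
   Context: Geometry: $\mathcal F$ is the set of all finite subsets of $\mathbb Z^d$; $|\Lambda|$ is the cardinality of $\Lambda\in\mathcal F$; $\mathfrak d(x,y):=\|x-y\|_1$ and $\mathfrak d(\Lambda_1,\Lambda_2):=\min\{\mathfrak d(x,y):x\in\Lambda_1,y\in\Lambda_2\}$; $\Lambda+z:=\{x+z: x\in\Lambda\}$. A cube of side length $n$ is a set $([0,n)^d\cap\mathbb Z^d)+z$, $z\in\mathbb Z^d$. Colorings: $\mathcal A$ carries the Borel $\sigma$-algebra $\mathcal B(\mathcal A)$ inherited from $\mathbb R$, and $\mathcal B(\Omega)$ is the product $\sigma$-algebra. For $z\in\mathbb Z^d$, $\tau_z\colon\Omega\to\Omega$, $(\tau_z\omega)_x:=\omega_{x+z}$.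 For $\Lambda\in\mathcal F$, $\Omega_\Lambda:=\mathcal A^\Lambda$ with product $\sigma$-algebra, $\Pi_\Lambda\colon\Omega\to\Omega_\Lambda$, $\Pi_\Lambda(\omega):=\omega_\Lambda:=(\omega_z)_{z\in\Lambda}$. Assumptions on $\mathbb P$: (M1) $\mathbb P\circ\tau_z^{-1}=\mathbb P$ for all $z\in\mathbb Z^d$. (M2) There are $\sigma$-finite measures $\mu_z$, $z\in\mathbb Z^d$, on $(\mathcal A,\mathcal B(\mathcal A))$ such that for each $\Lambda\in\mathcal F$ the marginal $\mathbb P_\Lambda:=\mathbb P\circ\Pi_\Lambda^{-1}$ is absolutely continuous with respect to $\mu_\Lambda:=\bigotimes_{z\in\Lambda}\mu_z$, with density $\rho_\Lambda:=d\mathbb P_\Lambda/d\mu_\Lambda$. (M3) There is $r\ge0$ (the correlation length) such that for all $n\in\mathbb N$ and non-empty $\Lambda_1,\dots,\Lambda_n\in\mathcal F$ with $\min\{\mathfrak d(\Lambda_i,\Lambda_j): i\ne j\}>r$ one has $\rho_\Lambda=\prod_{j=1}^n\rho_{\Lambda_j}$ ($\mu_\Lambda$-a.e., where $\rho_{\Lambda_j}$ is evaluated at $\omega_{\Lambda_j}$), $\Lambda=\bigcup_j\Lambda_j$. $\mathbb B:=\{F\colon\mathbb R\to\mathbb R\mid F\text{ right-continuous and bounded}\}$ with the supremum norm $\|\cdot\|$. A function $f\colon\mathcal F\times\Omega\to\mathbb B$ is admissible if: (i) $f(\Lambda+z,\omega)=f(\Lambda,\tau_z\omega)$ for all $\Lambda\in\mathcal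 F$, $z\in\mathbb Z^d$, $\omega\in\Omega$; (ii) $f(\Lambda,\omega)=f(\Lambda,\omega')$ whenever $\Lambda\in\mathcal F$ and $\Pi_\Lambda(\omega)=\Pi_\Lambda(\omega')$; (iii) there is $b\colon\mathcal F\to[0,\infty)$ such that for all $\omega\in\Omega$ and pairwise disjoint $\Lambda_1,\dots,\Lambda_n\in\mathcal F$ with union $\Lambda$, $\|f(\Lambda,\omega)-\sum_{i=1}^nf(\Lambda_i,\omega)\|\le\sum_{i=1}^nb(\Lambda_i)$, where $b(\Lambda+z)=b(\Lambda)$ for all $\Lambda\in\mathcal F,z\in\mathbb Z^d$; there is $D>0$ with $b(\Lambda)\le D|\Lambda|$ for all $\Lambda\in\mathcal F$; and $b(\Lambda_i)/|\Lambda_i|\to0$ for every sequence $(\Lambda_i)$ of cubes with strictly increasing side length; (iv) there is $s\in\{-1,1\}^{\mathbb Z^d}$ such that for all $\Lambda\in\mathcal F$, $\omega,\omega'\in\Omega$, $z\in\Lambda$, $E\in\mathbb R$ with $\omega_{\Lambda\setminus\{z\}}=\omega'_{\Lambda\setminus\{z\}}$ and $\omega_z\le\omega'_z$: $f(\Lambda,\omega)(E)\le f(\Lambda,\omega')(E)$ if $s(z)=1$, and $f(\Lambda,\omega)(E)\ge f(\Lambda,\omega')(E)$ if $s(z)=-1$; (v) $\sup_{\omega\in\Omega}\|f(\{0\},\omega)\|<\infty$. *)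

theory Defs
  imports "HOL-Probability.Probability"
begin

text \<open>
  The lattice of dimension \<open>d\<close> is the type \<open>int ^ 'd\<close> with \<open>d = CARD('d)\<close>, and \<open>\<F>\<close> is the
  collection of its finite subsets. Functions on \<open>\<F>\<close>, on \<open>\<Omega>\<close> or on their product are
  represented by total functions that are only constrained on finite sets and on elements
  of \<open>\<Omega>\<close>.
\<close>

type_synonym 'd lattice = "int ^ 'd"

definition l1_dist :: "'d::finite lattice \<Rightarrow> 'd lattice \<Rightarrow> int" where
  "l1_dist x y = (\<Sum>i\<in>UNIV. \<bar>x $ i - y $ i\<bar>)"

text \<open>Only meaningful for finite nonempty arguments.\<close>

definition set_l1_dist :: "'d::finite lattice set \<Rightarrow> 'd lattice set \<Rightarrow> int" where
  "set_l1_dist \<Lambda>1 \<Lambda>2 = Min {l1_dist x y | x y. x \<in> \<Lambda>1 \<and> y \<in> \<Lambda>2}"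

definition translate :: "'d::finite lattice set \<Rightarrow> 'd lattice \<Rightarrow> 'd lattice set" where
  "translate \<Lambda> z = (\<lambda>x. x + z) ` \<Lambda>"

definition lattice_box :: "nat \<Rightarrow> 'd::finite lattice set" where
  "lattice_box n = {x. \<forall>i. 0 \<le> x $ i \<and> x $ i < int n}"

definition is_cube :: "nat \<Rightarrow> 'd::finite lattice set \<Rightarrow> bool" where
  "is_cube n \<Lambda> \<longleftrightarrow> (\<exists>z. \<Lambda> = translate (lattice_box n) z)"

definition color_space :: "real set \<Rightarrow> real measure" where
  "color_space A = restrict_space borel A"

text \<open>
  The measurable spaces \<open>A\<^sup>\<Lambda>\<close>; only their carriers and \<open>\<sigma>\<close>-algebras are used. The
  configuration space \<open>\<Omega>\<close> is the case \<open>\<Lambda> = UNIV\<close>.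
\<close>

definition config_space :: "real set \<Rightarrow> 'd::finite lattice set \<Rightarrow> ('d lattice \<Rightarrow> real) measure" where
  "config_space A \<Lambda> = (\<Pi>\<^sub>M z\<in>\<Lambda>. color_space A)"

abbreviation configs :: "real set \<Rightarrow> ('d::finite lattice \<Rightarrow> real) set" where
  "configs A \<equiv> space (config_space A UNIV)"

definition shift_config :: "'d::finite lattice \<Rightarrow> ('d lattice \<Rightarrow> real) \<Rightarrow> 'd lattice \<Rightarrow> real" where
  "shift_config z \<omega> = (\<lambda>x. \<omega> (x + z))"

definition marginal ::
  "real set \<Rightarrow> ('d::finite lattice \<Rightarrow> real) measure \<Rightarrow> 'd lattice set \<Rightarrow> ('d lattice \<Rightarrow> real) measure" where
  "marginal A P \<Lambda> = distr P (config_space A \<Lambda>) (\<lambda>\<omega>. restrict \<omega> \<Lambda>)"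

definition marginal_density ::
  "real set \<Rightarrow> ('d::finite lattice \<Rightarrow> real) measure \<Rightarrow> ('d lattice \<Rightarrow> real measure) \<Rightarrow>
    'd lattice set \<Rightarrow> ('d lattice \<Rightarrow> real) \<Rightarrow> ennreal" where
  "marginal_density A P \<mu> \<Lambda> = RN_deriv (\<Pi>\<^sub>M z\<in>\<Lambda>. \<mu> z) (marginal A P \<Lambda>)"

definition M1 :: "real set \<Rightarrow> ('d::finite lattice \<Rightarrow> real) measure \<Rightarrow> bool" where
  "M1 A P \<longleftrightarrow> (\<forall>z. distr P (config_space A UNIV) (shift_config z) = P)"

definition M2 ::
  "real set \<Rightarrow> ('d::finite lattice \<Rightarrow> real) measure \<Rightarrow> ('d lattice \<Rightarrow> real measure) \<Rightarrow> bool" where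
  "M2 A P \<mu> \<longleftrightarrow>
     (\<forall>z. sets (\<mu> z) = sets (color_space A) \<and> sigma_finite_measure (\<mu> z)) \<and>
     (\<forall>\<Lambda>. finite \<Lambda> \<longrightarrow> absolutely_continuous (\<Pi>\<^sub>M z\<in>\<Lambda>. \<mu> z) (marginal A P \<Lambda>))"

definition M3 ::
  "real set \<Rightarrow> ('d::finite lattice \<Rightarrow> real) measure \<Rightarrow> ('d lattice \<Rightarrow> real measure) \<Rightarrow> nat \<Rightarrow> bool" where
  "M3 A P \<mu> r \<longleftrightarrow>
     (\<forall>(n::nat) \<Lambda>. n \<ge> 1 \<longrightarrow>
        (\<forall>j\<in>{1..n}. finite (\<Lambda> j) \<and> \<Lambda> j \<noteq> {}) \<longrightarrow>
        (\<forall>i\<in>{1..n}. \<forall>j\<in>{1..n}. i \<noteq> j \<longrightarrow> set_l1_dist (\<Lambda> i) (\<Lambda> j) > int r) \<longrightarrow>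
        (AE \<omega> in (\<Pi>\<^sub>M z\<in>(\<Union>j\<in>{1..n}. \<Lambda> j). \<mu> z).
           marginal_density A P \<mu> (\<Union>j\<in>{1..n}. \<Lambda> j) \<omega> =
           (\<Prod>j\<in>{1..n}. marginal_density A P \<mu> (\<Lambda> j) (restrict \<omega> (\<Lambda> j)))))"

definition rc_bounded :: "(real \<Rightarrow> real) set" where
  "rc_bounded = {F. (\<forall>E. continuous (at_right E) F) \<and> bounded (range F)}"

text \<open>The supremum norm; only meaningful for bounded functions.\<close>

definition sup_norm :: "(real \<Rightarrow> real) \<Rightarrow> real" where
  "sup_norm F = (SUP E. \<bar>F E\<bar>)"

definition almost_additive ::
  "real set \<Rightarrow> ('d::finite lattice set \<Rightarrow> ('d lattice \<Rightarrow> real) \<Rightarrow> real \<Rightarrow> real) \<Rightarrow>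
    ('d lattice set \<Rightarrow> real) \<Rightarrow> bool" where
  "almost_additive A f b \<longleftrightarrow>
     (\<forall>\<Lambda>. finite \<Lambda> \<longrightarrow> b \<Lambda> \<ge> 0) \<and>
     (\<forall>\<omega>\<in>configs A. \<forall>(n::nat) \<Lambda>. n \<ge> 1 \<longrightarrow> (\<forall>i\<in>{1..n}. finite (\<Lambda> i)) \<longrightarrow> disjoint_family_on \<Lambda> {1..n} \<longrightarrow>
        sup_norm (\<lambda>E. f (\<Union>i\<in>{1..n}. \<Lambda> i) \<omega> E - (\<Sum>i\<in>{1..n}. f (\<Lambda> i) \<omega> E))
          \<le> (\<Sum>i\<in>{1..n}. b (\<Lambda> i))) \<and>
     (\<forall>\<Lambda> z. finite \<Lambda> \<longrightarrow> b (translate \<Lambda> z) = b \<Lambda>) \<and>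
     (\<exists>D>0. \<forall>\<Lambda>. finite \<Lambda> \<longrightarrow> b \<Lambda> \<le> D * real (card \<Lambda>)) \<and>
     (\<forall>\<Lambda> l. strict_mono l \<longrightarrow> (\<forall>i::nat. is_cube (l i) (\<Lambda> i)) \<longrightarrow>
        (\<lambda>i. b (\<Lambda> i) / real (card (\<Lambda> i))) \<longlonglongrightarrow> 0)"

definition coordinatewise_monotone ::
  "real set \<Rightarrow> ('d::finite lattice set \<Rightarrow> ('d lattice \<Rightarrow> real) \<Rightarrow> real \<Rightarrow> real) \<Rightarrow>
    ('d lattice \<Rightarrow> int) \<Rightarrow> bool" where
  "coordinatewise_monotone A f s \<longleftrightarrow>
     (\<forall>z. s z \<in> {-1, 1}) \<and>
     (\<forall>\<Lambda>. finite \<Lambda> \<longrightarrow> (\<forall>\<omega>\<in>configs A. \<forall>\<omega>'\<in>configs A. \<forall>z\<in>\<Lambda>. \<forall>E.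
        restrict \<omega> (\<Lambda> - {z}) = restrict \<omega>' (\<Lambda> - {z}) \<longrightarrow> \<omega> z \<le> \<omega>' z \<longrightarrow>
          (s z = 1 \<longrightarrow> f \<Lambda> \<omega> E \<le> f \<Lambda> \<omega>' E) \<and>
          (s z = -1 \<longrightarrow> f \<Lambda> \<omega> E \<ge> f \<Lambda> \<omega>' E)))"

text \<open>The first conjunct says that \<open>f\<close> takes values in the right-continuous bounded functions.\<close>

definition admissible ::
  "real set \<Rightarrow> ('d::finite lattice set \<Rightarrow> ('d lattice \<Rightarrow> real) \<Rightarrow> real \<Rightarrow> real) \<Rightarrow> bool" where
  "admissible A f \<longleftrightarrow>
     (\<forall>\<Lambda>. finite \<Lambda> \<longrightarrow> (\<forall>\<omega>\<in>configs A. f \<Lambda> \<omega> \<in> rc_bounded)) \<and>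
     (\<forall>\<Lambda>. finite \<Lambda> \<longrightarrow> (\<forall>z. \<forall>\<omega>\<in>configs A. f (translate \<Lambda> z) \<omega> = f \<Lambda> (shift_config z \<omega>))) \<and>
     (\<forall>\<Lambda>. finite \<Lambda> \<longrightarrow> (\<forall>\<omega>\<in>configs A. \<forall>\<omega>'\<in>configs A.
        restrict \<omega> \<Lambda> = restrict \<omega>' \<Lambda> \<longrightarrow> f \<Lambda> \<omega> = f \<Lambda> \<omega>')) \<and>
     (\<exists>b. almost_additive A f b) \<and>
     (\<exists>s. coordinatewise_monotone A f s) \<and>
     bdd_above ((\<lambda>\<omega>. sup_norm (f {0} \<omega>)) ` configs A)"

end

theory Submission
  imports Defs
begin

text \<open>
  Almost additivity reduces an average over a large box to an average over many translates of one fixed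
  cube. Place cubes (tiles) of side \<open>m\<close> periodically with period \<open>m + r\<close> in the box \<open>\<Lambda>\<^sub>n\<close>. Up to the boundary
  term \<open>b\<close> of a tile per tile volume and a multiple of the volume fraction not covered by tiles,
  \<open>f(\<Lambda>\<^sub>n)/|\<Lambda>\<^sub>n|\<close> is the empirical mean, over the tiles, of \<open>f\<close> of one tile divided by its volume
  (lemma \<open>tiling_average_estimate\<close>). Both errors are uniform in the energy \<open>E\<close> and in the configuration, and
  small for large \<open>m\<close>. The patterns in the tiles are independent, because tiles are more than \<open>r\<close> apart, and
  identically distributed, because the measure is shift invariant. So for one \<open>E\<close> the law of large numbers
  applies.

  Uniformity in \<open>E\<close> comes from monotonicity. The energy only selects a member of a family of uniformly
  bounded functions of the tile pattern, each monotone in every coordinate with the same signs. With respect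
  to a product of probability measures the class of all such functions is covered by finitely many brackets
  of arbitrarily small \<open>L\<^sup>1\<close> size (lemma \<open>signed_monotone_finite_bracketing\<close>): along one axis the oscillations
  of a bounded monotone function over disjoint intervals sum to a bounded quantity, so cells of small mass
  contribute little, and a cell of large mass is a single point, where nothing oscillates. By (M2) the
  law of a tile pattern is absolutely continuous with respect to such a product, hence the brackets are small
  for it too, and the law of large numbers for the finitely many bracket functions gives a Glivenko-Cantelli
  theorem for the whole class (lemma \<open>tile_Glivenko_Cantelli\<close>).

  Thus for every \<open>\<epsilon>\<close> there is a function of \<open>E\<close> alone to which the averages are almost surely \<open>\<epsilon>\<close>-close in
  supremum norm from some \<open>n\<close> on. These functions converge uniformly as \<open>\<epsilon>\<close> tends to zero, and their limit is
  the required one; it is bounded and right-continuous as a uniform limit of such functions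
  (lemma \<open>deterministic_uniform_limit\<close>).
\<close>

section \<open>Finite bracketings of coordinatewise monotone functions\<close>

text \<open>
  Cutting the range of the distribution function into steps of height \<open>\<delta>\<close> gives cells of small mass,
  except that an atom heavier than \<open>\<delta>\<close> must be a cell of its own. Counting steps of both one-sided
  distribution functions separates such an atom from its neighbours: if two points \<open>x < y\<close> lie in the same
  cell, then \<open>M {x..y} \<le> \<delta>\<close>.
\<close>

lemma fine_monotone_partition:
  fixes M :: "real measure"
  assumes fin: "finite_measure M" and sets: "sets M = sets borel" and \<delta>: "0 < \<delta>"
  obtains \<kappa> :: "real \<Rightarrow> nat" and N :: nat
  where "mono \<kappa>" "\<And>x. \<kappa> x < N"
    "\<And>k. measure M {x. \<kappa> x = k} \<le> \<delta> \<or> (\<exists>t. {x. \<kappa> x = k} = {t})"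
proof -
  interpret finite_measure M by (rule fin)
  have space: "space M = UNIV" using sets_eq_imp_space_eq[OF sets] by simp
  note [measurable_cong] = sets
  define F where "F x = measure M {..x}" for x
  define G where "G x = measure M {..<x}" for x
  have GF: "G x \<le> F x" for x unfolding F_def G_def by (intro finite_measure_mono) auto
  have FG: "F x \<le> G y" if "x < y" for x y
    unfolding F_def G_def using that by (intro finite_measure_mono) auto
  have F: "F x \<le> F y" if "x \<le> y" for x y
    unfolding F_def using that by (intro finite_measure_mono) auto
  have G: "G x \<le> G y" if "x \<le> y" for x y
    unfolding G_def using that by (intro finite_measure_mono) auto
  have G0: "0 \<le> G x" for x by (simp add: G_def)
  have F1: "F x \<le> measure M UNIV" for x
    unfolding F_def by (intro finite_measure_mono) auto
  define c where "c u = nat \<lfloor>u / \<delta>\<rfloor>" for u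
  have c: "c u \<le> c v" if "u \<le> v" for u v
    unfolding c_def using that \<delta> by (intro nat_mono floor_mono divide_right_mono) auto
  \<comment> \<open>\<open>F\<close> and \<open>G\<close> are the right- and left-continuous distribution functions; \<open>\<kappa>\<close> jumps when one of them
    crosses a multiple of \<open>\<delta>\<close>.\<close>
  define \<kappa> where "\<kappa> x = c (F x) + c (G x)" for x
  have "mono \<kappa>" unfolding \<kappa>_def by (intro monoI add_mono c F G)
  have less: "\<kappa> x < Suc (2 * c (measure M UNIV))" for x
    using c[OF F1[of x]] c[OF order_trans[OF GF F1[of x]]] by (simp add: \<kappa>_def)
  have close: "F y - G x \<le> \<delta>" if "\<kappa> x = \<kappa> y" "x < y" for x y
  proof -
    have "c (G x) \<le> c (F x)" "c (F x) \<le> c (G y)" "c (G y) \<le> c (F y)"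
      using GF FG[OF that(2)] by (auto intro!: c)
    with that(1) have "c (G x) = c (F y)"
      unfolding \<kappa>_def using c[OF F] c[OF G] that(2) by linarith
    moreover have "0 \<le> G x / \<delta>" "0 \<le> F y / \<delta>" using \<delta> G0[of x] by (auto simp: F_def)
    ultimately have "\<lfloor>G x / \<delta>\<rfloor> = \<lfloor>F y / \<delta>\<rfloor>"
      by (simp add: c_def eq_nat_nat_iff)
    then have "F y / \<delta> - G x / \<delta> < 1" by linarith
    then show ?thesis using \<delta> by (simp add: field_simps)
  qed
  have cell: "measure M {x. \<kappa> x = k} \<le> \<delta>" if nt: "\<nexists>t. {x. \<kappa> x = k} = {t}" for k
  proof -
    let ?I = "{x. \<kappa> x = k}"
    have meas: "?I \<in> sets borel"
    proof -
      have "(\<lambda>x. real (\<kappa> x)) \<in> borel_measurable borel"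
        by (rule borel_measurable_mono) (use \<open>mono \<kappa>\<close> in \<open>auto simp: mono_def\<close>)
      then have "(\<lambda>x. real (\<kappa> x)) -` {real k} \<inter> space borel \<in> sets borel" by (rule measurable_sets) auto
      then show ?thesis by (simp add: vimage_def)
    qed
    have K: "measure M K \<le> \<delta>" if K: "compact K" "K \<subseteq> ?I" for K
    proof (cases "K = {}")
      case True then show ?thesis using \<delta> by simp
    next
      case False
      obtain p where p: "p \<in> K" "\<And>y. y \<in> K \<Longrightarrow> p \<le> y" using compact_attains_inf[OF K(1) False] by auto
      obtain q where q: "q \<in> K" "\<And>y. y \<in> K \<Longrightarrow> y \<le> q" using compact_attains_sup[OF K(1) False] by auto
      obtain t where t: "\<kappa> t = k" "t \<noteq> p" using nt K p(1) by blast
      have pk: "\<kappa> p = k" "\<kappa> q = k" using p(1) q(1) K(2) by auto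
      let ?p = "min p t" and ?q = "max q t"
      have pq: "?p < ?q" "\<kappa> ?p = \<kappa> ?q"
        using t pk p(2)[OF q(1)] by (auto simp: min_def max_def)
      have "measure M K \<le> measure M {?p..?q}"
        using p(2) q(2) by (intro finite_measure_mono) (auto simp: min_le_iff_disj le_max_iff_disj)
      also have "{?p..?q} = {..?q} - {..<?p}" by auto
      also have "measure M \<dots> = F ?q - G ?p"
        unfolding F_def G_def using pq(1) by (intro finite_measure_Diff) auto
      also have "\<dots> \<le> \<delta>" by (rule close) (use pq in auto)
      finally show ?thesis .
    qed
    \<comment> \<open>The cell need not be closed, so its mass is computed from compact subsets, which have end points.\<close>
    have "emeasure M ?I = (SUP K\<in>{K. K \<subseteq> ?I \<and> compact K}. emeasure M K)"
      using meas by (intro inner_regular sets) (auto simp: space emeasure_finite)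
    also have "\<dots> \<le> ennreal \<delta>"
      using K by (intro SUP_least) (auto simp: emeasure_eq_measure intro!: ennreal_leI)
    finally show ?thesis using \<delta> by (simp add: emeasure_eq_measure)
  qed
  show thesis
    by (rule that[of \<kappa> "Suc (2 * c (measure M UNIV))"]) (use \<open>mono \<kappa>\<close> less cell in auto)
qed

text \<open>
  The sign \<open>s i\<close> says whether a function increases or decreases in coordinate \<open>i\<close>. Values in \<open>[0, 1]\<close>
  are a normalisation.
\<close>

definition signed_monotone :: "real set \<Rightarrow> ('i \<Rightarrow> real) \<Rightarrow> 'i set \<Rightarrow> (('i \<Rightarrow> real) \<Rightarrow> real) set" where
  "signed_monotone A s J = {g.
     (\<forall>x\<in>J \<rightarrow>\<^sub>E A. 0 \<le> g x \<and> g x \<le> 1) \<and>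
     (\<forall>x\<in>J \<rightarrow>\<^sub>E A. \<forall>y\<in>J \<rightarrow>\<^sub>E A. (\<forall>i\<in>J. s i * x i \<le> s i * y i) \<longrightarrow> g x \<le> g y)}"

text \<open>
  Both ends of a bracket are required to be measurable, because a monotone function of several
  variables can fail to be Borel and can then be integrated only through its brackets.
\<close>

definition is_bracket :: "'a measure \<Rightarrow> real \<Rightarrow> ('a \<Rightarrow> real) \<times> ('a \<Rightarrow> real) \<Rightarrow> bool" where
  "is_bracket M \<delta> b \<longleftrightarrow>
     fst b \<in> borel_measurable M \<and> snd b \<in> borel_measurable M \<and>
     (\<forall>x\<in>space M. 0 \<le> fst b x \<and> fst b x \<le> snd b x \<and> snd b x \<le> 1) \<and>
     (\<integral>x. snd b x - fst b x \<partial>M) \<le> \<delta>"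

definition in_bracket :: "'a set \<Rightarrow> ('a \<Rightarrow> real) \<Rightarrow> ('a \<Rightarrow> real) \<times> ('a \<Rightarrow> real) \<Rightarrow> bool" where
  "in_bracket S g b \<longleftrightarrow> (\<forall>x\<in>S. fst b x \<le> g x \<and> g x \<le> snd b x)"

text \<open>
  For a monotone function \<open>g\<close> and a point \<open>t\<close> of cell \<open>k\<close> these are bounds for the value at \<open>t\<close> that
  depend on the remaining coordinates only. The infimum runs over all cells from \<open>k\<close> on, the supremum over
  all cells up to \<open>k\<close>, which makes them monotone in \<open>k\<close> and meaningful for empty cells; the added values
  \<open>1\<close> and \<open>0\<close> keep them in \<open>[0, 1]\<close> if no cell is left.
\<close>

definition lower_envelope ::
  "real set \<Rightarrow> (real \<Rightarrow> nat) \<Rightarrow> 'i \<Rightarrow> (('i \<Rightarrow> real) \<Rightarrow> real) \<Rightarrow> nat \<Rightarrow> ('i \<Rightarrow> real) \<Rightarrow> real" where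
  "lower_envelope A \<kappa> z g k x = Inf (insert 1 {g (x(z := t)) |t. t \<in> A \<and> k \<le> \<kappa> t})"

definition upper_envelope ::
  "real set \<Rightarrow> (real \<Rightarrow> nat) \<Rightarrow> 'i \<Rightarrow> (('i \<Rightarrow> real) \<Rightarrow> real) \<Rightarrow> nat \<Rightarrow> ('i \<Rightarrow> real) \<Rightarrow> real" where
  "upper_envelope A \<kappa> z g k x = Sup (insert 0 {g (x(z := t)) |t. t \<in> A \<and> \<kappa> t \<le> k})"

text \<open>
  This bounds the gap of a bracket that is glued from cells. Here \<open>w k\<close> is the mass of cell \<open>k\<close>,
  \<open>\<alpha> k\<close> and \<open>\<beta> k\<close> are the integrals of the ends of a bracket for the lower envelope, \<open>\<alpha>' k\<close> and \<open>\<beta>' k\<close>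
  those for the upper envelope. Since the upper envelope of a cell lies below the lower envelope of the next
  one, the oscillations over the cells add up to at most \<open>1\<close> up to bracket gaps, so small cells contribute
  about \<open>\<delta>\<close> in total.
\<close>

lemma telescoping_cell_bound:
  fixes w \<alpha> \<beta> \<alpha>' \<beta>' :: "nat \<Rightarrow> real"
  assumes w: "\<And>k. k < N \<Longrightarrow> 0 \<le> w k \<and> w k \<le> 1"
    and gap: "\<And>k. k \<le> N \<Longrightarrow> \<beta> k - \<alpha> k \<le> \<eta>" and gap': "\<And>k. k < N \<Longrightarrow> \<beta>' k - \<alpha>' k \<le> \<eta>"
    and mono: "\<And>k. k < N \<Longrightarrow> \<alpha> k \<le> \<beta> (Suc k)" and cross: "\<And>k. k < N \<Longrightarrow> w k \<le> \<delta> \<Longrightarrow> \<alpha>' k \<le> \<beta> (Suc k)"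
    and same: "\<And>k. k < N \<Longrightarrow> \<not> w k \<le> \<delta> \<Longrightarrow> \<beta>' k = \<beta> k"
    and range: "0 \<le> \<beta> 0" "\<beta> N \<le> 1" and nonneg: "0 \<le> \<delta>" "0 \<le> \<eta>"
  shows "(\<Sum>k<N. w k * (\<beta>' k - \<alpha> k)) \<le> real N * \<eta> + \<delta> * (2 * real N * \<eta> + 1)"
proof -
  have "w k * (\<beta>' k - \<alpha> k) \<le> \<eta> + \<delta> * (2 * \<eta> + (\<beta> (Suc k) - \<beta> k))" if k: "k < N" for k
  proof -
    define d where "d = 2 * \<eta> + (\<beta> (Suc k) - \<beta> k)"
    have d0: "0 \<le> d" using gap[of k] mono[OF k] nonneg k by (simp add: d_def)
    show ?thesis
    proof (cases "w k \<le> \<delta>")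
      case True
      have "\<beta>' k - \<alpha> k \<le> d" using gap[of k] gap'[OF k] cross[OF k True] k by (simp add: d_def)
      then have "w k * (\<beta>' k - \<alpha> k) \<le> w k * d" using w[OF k] by (intro mult_left_mono) auto
      also have "\<dots> \<le> \<delta> * d" using True d0 by (rule mult_right_mono)
      finally show ?thesis using nonneg by (simp add: d_def)
    next
      case False
      have "w k * (\<beta>' k - \<alpha> k) \<le> w k * \<eta>"
        using gap[of k] k w[OF k] same[OF k False] by (intro mult_left_mono) auto
      also have "\<dots> \<le> \<eta>" using w[OF k] nonneg by (simp add: mult_left_le_one_le)
      finally show ?thesis using nonneg d0 unfolding d_def[symmetric]
        by (smt (verit) mult_nonneg_nonneg)
    qed
  qed
  then have "(\<Sum>k<N. w k * (\<beta>' k - \<alpha> k)) \<le> (\<Sum>k<N. \<eta> + \<delta> * (2 * \<eta> + (\<beta> (Suc k) - \<beta> k)))"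
    by (intro sum_mono) auto
  also have "\<dots> = real N * \<eta> + \<delta> * (\<Sum>k<N. 2 * \<eta> + (\<beta> (Suc k) - \<beta> k))"
    by (simp only: sum.distrib[of "\<lambda>_. \<eta>"] sum_distrib_left[symmetric]) simp
  also have "(\<Sum>k<N. 2 * \<eta> + (\<beta> (Suc k) - \<beta> k)) = 2 * real N * \<eta> + (\<beta> N - \<beta> 0)"
    by (simp only: sum.distrib sum_lessThan_telescope) simp
  finally show ?thesis
    using mult_left_mono[of "2 * real N * \<eta> + (\<beta> N - \<beta> 0)" "2 * real N * \<eta> + 1" \<delta>] range nonneg
    by linarith
qed

lemma signed_monotoneD:
  assumes "g \<in> signed_monotone A s J"
  shows "x \<in> J \<rightarrow>\<^sub>E A \<Longrightarrow> 0 \<le> g x" "x \<in> J \<rightarrow>\<^sub>E A \<Longrightarrow> g x \<le> 1"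
    and "x \<in> J \<rightarrow>\<^sub>E A \<Longrightarrow> y \<in> J \<rightarrow>\<^sub>E A \<Longrightarrow> \<forall>i\<in>J. s i * x i \<le> s i * y i \<Longrightarrow> g x \<le> g y"
  using assms unfolding signed_monotone_def by blast+

lemma signed_monotoneI:
  assumes "\<And>x. x \<in> J \<rightarrow>\<^sub>E A \<Longrightarrow> 0 \<le> g x" "\<And>x. x \<in> J \<rightarrow>\<^sub>E A \<Longrightarrow> g x \<le> 1"
    and "\<And>x y. x \<in> J \<rightarrow>\<^sub>E A \<Longrightarrow> y \<in> J \<rightarrow>\<^sub>E A \<Longrightarrow> \<forall>i\<in>J. s i * x i \<le> s i * y i \<Longrightarrow> g x \<le> g y"
  shows "g \<in> signed_monotone A s J"
  using assms unfolding signed_monotone_def by blast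

text \<open>
  The envelopes of a monotone function are monotone in the remaining coordinates, they bracket the
  function on each cell, and consecutive ones interlace. On a cell with one point they coincide, so atoms
  cause no oscillation.
\<close>

lemma cell_envelopes:
  fixes g :: "('i \<Rightarrow> real) \<Rightarrow> real" and \<kappa> :: "real \<Rightarrow> nat"
  assumes z: "z \<notin> J" and g: "g \<in> signed_monotone A s (insert z J)"
    and \<kappa>_mono: "\<forall>t t'. \<kappa> t < \<kappa> t' \<longrightarrow> s z * t \<le> s z * t'"
  defines "Glo \<equiv> lower_envelope A \<kappa> z g" and "Gup \<equiv> upper_envelope A \<kappa> z g"
  shows "Glo k \<in> signed_monotone A s J" "Gup k \<in> signed_monotone A s J"
    and "x \<in> J \<rightarrow>\<^sub>E A \<Longrightarrow> t \<in> A \<Longrightarrow> Glo (\<kappa> t) x \<le> g (x(z := t)) \<and> g (x(z := t)) \<le> Gup (\<kappa> t) x"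
    and "x \<in> J \<rightarrow>\<^sub>E A \<Longrightarrow> Gup k x \<le> Glo (Suc k) x" "x \<in> J \<rightarrow>\<^sub>E A \<Longrightarrow> Glo k x \<le> Glo (Suc k) x"
    and "x \<in> J \<rightarrow>\<^sub>E A \<Longrightarrow> t \<in> A \<Longrightarrow> {t'. \<kappa> t' = \<kappa> t} = {t} \<Longrightarrow> Gup (\<kappa> t) x = Glo (\<kappa> t) x"
proof -
  note \<kappa> = \<kappa>_mono[rule_format]
  have upd: "x(z := t) \<in> insert z J \<rightarrow>\<^sub>E A" if "x \<in> J \<rightarrow>\<^sub>E A" "t \<in> A" for x t
    using that by (intro PiE_fun_upd)
  have g01: "0 \<le> g (x(z := t))" "g (x(z := t)) \<le> 1" if "x \<in> J \<rightarrow>\<^sub>E A" "t \<in> A" for x t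
    by (rule signed_monotoneD[OF g upd[OF that]])+
  have gm: "g (x(z := t)) \<le> g (y(z := t'))"
    if "x \<in> J \<rightarrow>\<^sub>E A" "y \<in> J \<rightarrow>\<^sub>E A" "t \<in> A" "t' \<in> A" "\<forall>i\<in>J. s i * x i \<le> s i * y i" "s z * t \<le> s z * t'"
    for x y t t'
  proof -
    have "\<forall>i\<in>insert z J. s i * (x(z := t)) i \<le> s i * (y(z := t')) i" using that z by auto
    then show ?thesis by (rule signed_monotoneD(3)[OF g upd[OF that(1,3)] upd[OF that(2,4)]])
  qed
  have bdd: "bdd_below (insert 1 {g (x(z := t)) |t. t \<in> A \<and> Q t})"
    "bdd_above (insert 0 {g (x(z := t)) |t. t \<in> A \<and> Q t})" if x: "x \<in> J \<rightarrow>\<^sub>E A" for x Q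
    by (rule bdd_belowI[of _ 0], use x g01 in force) (rule bdd_aboveI[of _ 1], use x g01 in force)
  have lo_le: "Glo k x \<le> g (x(z := t))" if "x \<in> J \<rightarrow>\<^sub>E A" "t \<in> A" "k \<le> \<kappa> t" for x t k
    unfolding Glo_def lower_envelope_def by (rule cInf_lower[OF _ bdd(1)[OF that(1)]]) (use that in blast)
  have lo_1: "Glo k x \<le> 1" if "x \<in> J \<rightarrow>\<^sub>E A" for x k
    unfolding Glo_def lower_envelope_def by (rule cInf_lower[OF _ bdd(1)[OF that]]) simp
  have le_lo: "c \<le> Glo k x" if "c \<le> 1" "\<And>t. t \<in> A \<Longrightarrow> k \<le> \<kappa> t \<Longrightarrow> c \<le> g (x(z := t))" for c x k
    unfolding Glo_def lower_envelope_def using that by (intro cInf_greatest) blast+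
  have le_up: "g (x(z := t)) \<le> Gup k x" if "x \<in> J \<rightarrow>\<^sub>E A" "t \<in> A" "\<kappa> t \<le> k" for x t k
    unfolding Gup_def upper_envelope_def by (rule cSup_upper[OF _ bdd(2)[OF that(1)]]) (use that in blast)
  have up_0: "0 \<le> Gup k x" if "x \<in> J \<rightarrow>\<^sub>E A" for x k
    unfolding Gup_def upper_envelope_def by (rule cSup_upper[OF _ bdd(2)[OF that]]) simp
  have up_le: "Gup k x \<le> c" if "0 \<le> c" "\<And>t. t \<in> A \<Longrightarrow> \<kappa> t \<le> k \<Longrightarrow> g (x(z := t)) \<le> c" for c x k
    unfolding Gup_def upper_envelope_def using that by (intro cSup_least) blast+
  show "Glo k \<in> signed_monotone A s J"
  proof (rule signed_monotoneI)
    fix x assume x: "x \<in> J \<rightarrow>\<^sub>E A"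
    show "0 \<le> Glo k x" by (rule le_lo) (use x g01 in simp_all)
    show "Glo k x \<le> 1" by (rule lo_1[OF x])
    fix y assume y: "y \<in> J \<rightarrow>\<^sub>E A" and xy: "\<forall>i\<in>J. s i * x i \<le> s i * y i"
    show "Glo k x \<le> Glo k y"
    proof (rule le_lo)
      show "Glo k x \<le> g (y(z := t))" if "t \<in> A" "k \<le> \<kappa> t" for t
        by (rule order_trans[OF lo_le[OF x that] gm[OF x y that(1,1) xy order_refl]])
    qed (rule lo_1[OF x])
  qed
  show "Gup k \<in> signed_monotone A s J"
  proof (rule signed_monotoneI)
    fix x assume x: "x \<in> J \<rightarrow>\<^sub>E A"
    show "0 \<le> Gup k x" by (rule up_0[OF x])
    show "Gup k x \<le> 1" by (rule up_le) (use x g01 in simp_all)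
    fix y assume y: "y \<in> J \<rightarrow>\<^sub>E A" and xy: "\<forall>i\<in>J. s i * x i \<le> s i * y i"
    show "Gup k x \<le> Gup k y"
    proof (rule up_le)
      show "g (x(z := t)) \<le> Gup k y" if "t \<in> A" "\<kappa> t \<le> k" for t
        by (rule order_trans[OF gm[OF x y that(1,1) xy order_refl] le_up[OF y that]])
    qed (rule up_0[OF y])
  qed
  show "Glo (\<kappa> t) x \<le> g (x(z := t)) \<and> g (x(z := t)) \<le> Gup (\<kappa> t) x" if "x \<in> J \<rightarrow>\<^sub>E A" "t \<in> A"
    using lo_le[OF that order_refl] le_up[OF that order_refl] by simp
  show "Gup k x \<le> Glo (Suc k) x" if x: "x \<in> J \<rightarrow>\<^sub>E A"
  proof (rule up_le)
    show "0 \<le> Glo (Suc k) x" by (rule le_lo) (use x g01 in simp_all)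
    fix t assume t: "t \<in> A" "\<kappa> t \<le> k"
    show "g (x(z := t)) \<le> Glo (Suc k) x"
    proof (rule le_lo)
      show "g (x(z := t)) \<le> g (x(z := t'))" if "t' \<in> A" "Suc k \<le> \<kappa> t'" for t'
        using t that by (intro gm x \<kappa>) auto
    qed (use x t g01 in simp)
  qed
  show "Glo k x \<le> Glo (Suc k) x" if x: "x \<in> J \<rightarrow>\<^sub>E A"
    by (rule le_lo[OF lo_1[OF x]]) (use x in \<open>auto intro!: lo_le\<close>)
  show "Gup (\<kappa> t) x = Glo (\<kappa> t) x" if x: "x \<in> J \<rightarrow>\<^sub>E A" "t \<in> A" "{t'. \<kappa> t' = \<kappa> t} = {t}"
  proof (rule antisym)
    have eq: "t' = t" if "\<kappa> t' = \<kappa> t" for t' using x(3) that by auto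
    show "Gup (\<kappa> t) x \<le> Glo (\<kappa> t) x"
    proof (rule up_le)
      show "0 \<le> Glo (\<kappa> t) x" by (rule le_lo) (use x g01 in simp_all)
      fix t' assume t': "t' \<in> A" "\<kappa> t' \<le> \<kappa> t"
      have lo: "s z * t' \<le> s z * t" using t' eq[of t'] \<kappa>[of t' t] by (cases "\<kappa> t' = \<kappa> t") auto
      show "g (x(z := t')) \<le> Glo (\<kappa> t) x"
      proof (rule le_lo)
        fix u assume u: "u \<in> A" "\<kappa> t \<le> \<kappa> u"
        have "s z * t \<le> s z * u" using u eq[of u] \<kappa>[of t u] by (cases "\<kappa> u = \<kappa> t") auto
        with lo show "g (x(z := t')) \<le> g (x(z := u))"
          by (intro gm x t' u) auto
      qed (use x t' g01 in simp)
    qed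
    show "Glo (\<kappa> t) x \<le> Gup (\<kappa> t) x"
      using x lo_le[of x t "\<kappa> t"] le_up[of x t "\<kappa> t"] by auto
  qed
qed

lemma in_bracketD:
  assumes "in_bracket S g b" "x \<in> S"
  shows "fst b x \<le> g x" "g x \<le> snd b x"
  using assms by (auto simp: in_bracket_def)

text \<open>
  Without coordinates a function is a number in \<open>[0, 1]\<close>, located up to \<open>1 / n\<close> by a grid.
\<close>

lemma signed_monotone_empty_finite_bracketing:
  fixes M :: "('i \<Rightarrow> real) measure"
  assumes M: "prob_space M" "space M = {\<lambda>_. undefined}" and \<delta>: "0 < \<delta>"
  shows "\<exists>B. finite B \<and> (\<forall>b\<in>B. is_bracket M \<delta> b) \<and>
           (\<forall>g\<in>signed_monotone A s {}. \<exists>b\<in>B. in_bracket (space M) g b)"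
proof -
  interpret prob_space M by fact
  obtain n :: nat where n: "1 / \<delta> < real n" using reals_Archimedean2 by blast
  have n0: "0 < n"
  proof (rule ccontr)
    assume "\<not> 0 < n"
    then have "1 / \<delta> < 0" using n by simp
    then show False using \<delta> by (simp add: field_simps)
  qed
  let ?b = "\<lambda>k::nat. ((\<lambda>_. real k / real n) :: ('i \<Rightarrow> real) \<Rightarrow> real, (\<lambda>_. min 1 (real (Suc k) / real n)) :: ('i \<Rightarrow> real) \<Rightarrow> real)"
  show ?thesis
  proof (intro exI[of _ "?b ` {..n}"] conjI ballI)
    fix b assume "b \<in> ?b ` {..n}"
    then obtain k where k: "k \<le> n" "b = ?b k" by auto
    have "min 1 (real (Suc k) / real n) - real k / real n \<le> 1 / real n"
      using min.cobounded2[of 1 "real (Suc k) / real n"] by (simp add: add_divide_distrib)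
    also have "1 / real n \<le> \<delta>" using n n0 \<delta> by (simp add: field_simps)
    finally have gap: "min 1 (real (Suc k) / real n) - real k / real n \<le> \<delta>" .
    have "real k / real n \<le> min 1 (real (Suc k) / real n)"
      using k n0 by (simp add: divide_right_mono)
    with gap show "is_bracket M \<delta> b"
      by (simp add: k is_bracket_def prob_space)
  next
    fix g :: "('i \<Rightarrow> real) \<Rightarrow> real" assume g: "g \<in> signed_monotone A s {}"
    let ?u = "\<lambda>_::'i. undefined :: real"
    have g01: "0 \<le> g ?u" "g ?u \<le> 1" using g by (auto simp: signed_monotone_def)
    define k where "k = nat \<lfloor>g ?u * real n\<rfloor>"
    have kk: "real k \<le> g ?u * real n" "g ?u * real n < real k + 1"
      using mult_nonneg_nonneg[OF g01(1), of "real n"] unfolding k_def by linarith+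
    have "real k \<le> 1 * real n"
      using order_trans[OF kk(1) mult_right_mono[OF g01(2)]] by simp
    then have "k \<le> n" by simp
    moreover have "in_bracket (space M) g (?b k)"
      using kk n0 g01 by (simp add: in_bracket_def M(2) pos_divide_le_eq pos_le_divide_eq)
    ultimately show "\<exists>b\<in>?b ` {..n}. in_bracket (space M) g b" by blast
  qed auto
qed

text \<open>
  Coordinatewise monotone functions form a totally bounded class in the bracketing sense. The proof
  removes one coordinate \<open>z\<close>: on each cell of a fine partition of that axis the function lies between two
  monotone functions of the other coordinates, for which the induction hypothesis supplies brackets, and the
  glued bracket is controlled by telescoping along the axis. Only the product structure of the measure
  matters; its factors may have atoms.
\<close>

lemma signed_monotone_finite_bracketing:
  fixes m :: "'i \<Rightarrow> real measure" and A :: "real set" and s :: "'i \<Rightarrow> real"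
  assumes J: "finite J" and prob: "\<And>i. prob_space (m i)"
    and sets: "\<And>i. sets (m i) = sets (restrict_space borel A)"
    and s: "\<And>i. s i = 1 \<or> s i = -1" and \<delta>: "0 < \<delta>"
  shows "\<exists>B. finite B \<and> (\<forall>b\<in>B. is_bracket (PiM J m) \<delta> b) \<and>
           (\<forall>g\<in>signed_monotone A s J. \<exists>b\<in>B. in_bracket (space (PiM J m)) g b)"
  using J \<delta>
proof (induction J arbitrary: \<delta> rule: finite_induct)
  case empty
  show ?case
    by (rule signed_monotone_empty_finite_bracketing)
       (use prob empty in \<open>auto intro: prob_space_PiM simp: space_PiM\<close>)
next
  case (insert z J)
  interpret mz: prob_space "m z" by (rule prob)
  interpret P: prob_space "PiM J m" by (intro prob_space_PiM prob)
  interpret P': prob_space "PiM (insert z J) m" by (intro prob_space_PiM prob)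
  interpret product_prob_space m J by (intro product_prob_spaceI prob)
  note [measurable_cong] = sets
  have space_m: "space (m i) = A" for i
    using sets_eq_imp_space_eq[OF sets] by (simp add: space_restrict_space)
  have space_J: "space (PiM K m) = K \<rightarrow>\<^sub>E A" for K by (simp add: space_PiM space_m)
  have id [measurable]: "(\<lambda>x. x) \<in> borel_measurable (m i)" for i
    by (simp add: measurable_cong_sets[OF sets refl] measurable_restrict_space1)
  \<comment> \<open>Cells of the new coordinate, numbered so that the sign-adjusted coordinate increases with the number.\<close>
  have \<delta>4: "0 < \<delta> / 4" using insert.prems by simp
  have fin: "finite_measure (distr (m z) borel (\<lambda>x. x))"
    by (intro mz.finite_measure_distr) simp
  obtain \<kappa>0 :: "real \<Rightarrow> nat" and N0 where \<kappa>0: "mono \<kappa>0" "\<And>x. \<kappa>0 x < N0"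
      "\<And>k. measure (distr (m z) borel (\<lambda>x. x)) {x. \<kappa>0 x = k} \<le> \<delta> / 4 \<or> (\<exists>t. {x. \<kappa>0 x = k} = {t})"
    by (rule fine_monotone_partition[OF fin sets_distr \<delta>4]) (rule that)
  define \<kappa> where "\<kappa> = (\<lambda>t. if s z = 1 then \<kappa>0 t else N0 - Suc (\<kappa>0 t))"
  have N0: "0 < N0" using \<kappa>0(2)[of 0] by simp
  have \<kappa>_less: "\<kappa> t < N0" for t using \<kappa>0(2)[of t] by (auto simp: \<kappa>_def)
  have \<kappa>_mono: "\<forall>t t'. \<kappa> t < \<kappa> t' \<longrightarrow> s z * t \<le> s z * t'"
  proof (intro allI impI)
    fix t t' assume that: "\<kappa> t < \<kappa> t'"
    show "s z * t \<le> s z * t'"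
    proof (cases "s z = 1")
      case True
      then have "\<not> t' \<le> t" using that monoD[OF \<kappa>0(1), of t' t] by (auto simp: \<kappa>_def)
      with True show ?thesis by simp
    next
      case False
      then have "\<not> t \<le> t'" using that monoD[OF \<kappa>0(1), of t t'] by (auto simp: \<kappa>_def)
      with False s[of z] show ?thesis by simp
    qed
  qed
  have \<kappa>0_fibre: "\<exists>k'. {x. \<kappa> x = k} = {x. \<kappa>0 x = k'}" for k
  proof (cases "s z = 1 \<or> N0 \<le> k")
    case True
    then have "{x. \<kappa> x = k} = {x. \<kappa>0 x = k}"
    proof
      assume "N0 \<le> k"
      then have "\<kappa> x \<noteq> k" "\<kappa>0 x \<noteq> k" for x
        using \<kappa>_less[of x] \<kappa>0(2)[of x] by linarith+
      then show ?thesis by simp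
    qed (simp add: \<kappa>_def)
    then show ?thesis by blast
  next
    case False
    have "N0 - Suc (\<kappa>0 x) = k \<longleftrightarrow> \<kappa>0 x = N0 - Suc k" for x using \<kappa>0(2)[of x] False by auto
    with False show ?thesis by (auto simp: \<kappa>_def)
  qed
  have "(\<lambda>x. real (\<kappa>0 x)) \<in> borel_measurable borel"
    by (rule borel_measurable_mono) (use \<kappa>0(1) in \<open>auto simp: mono_def\<close>)
  then have "(\<lambda>x. real (\<kappa>0 x)) -` {real k} \<inter> space borel \<in> sets borel" for k
    by (rule measurable_sets) auto
  then have \<kappa>0_meas: "{x. \<kappa>0 x = k} \<in> sets borel" for k by (simp add: vimage_def)
  then have [measurable]: "{x. \<kappa> x = k} \<in> sets borel" for k using \<kappa>0_fibre[of k] by metis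
  have ind: "(indicator {x. \<kappa> x = k} :: real \<Rightarrow> real) \<in> borel_measurable (m z)" for k
    using measurable_compose[OF id[of z], of "indicator {x. \<kappa> x = k}" borel] by simp
  define w where "w k = measure (m z) ({x. \<kappa> x = k} \<inter> A)" for k
  have w01: "0 \<le> w k" "w k \<le> 1" for k by (auto simp: w_def)
  have cell: "w k \<le> \<delta> / 4 \<or> (\<exists>t. {x. \<kappa> x = k} = {t})" for k
  proof -
    have "w k = measure (distr (m z) borel (\<lambda>x. x)) {x. \<kappa> x = k}"
      unfolding w_def by (subst measure_distr) (auto simp: space_m vimage_def)
    with \<kappa>0(3) \<kappa>0_fibre[of k] show ?thesis by metis
  qed
  \<comment> \<open>The number of cells is fixed before the accuracy for the remaining coordinates is chosen: the
    error terms are \<open>N0 * \<eta> \<le> \<delta> / 4\<close> and \<open>(\<delta> / 4) * (2 * N0 * \<eta> + 1) \<le> 3 * \<delta> / 4\<close>.\<close>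
  define \<eta> where "\<eta> = min 1 (\<delta> / 4) / (real N0 + 1)"
  have \<eta>: "0 < \<eta>" using insert.prems by (simp add: \<eta>_def)
  have N\<eta>: "real N0 * \<eta> \<le> min 1 (\<delta> / 4)"
  proof -
    have "real N0 * \<eta> \<le> (real N0 + 1) * \<eta>" using \<eta> by (simp add: algebra_simps)
    then show ?thesis by (simp add: \<eta>_def)
  qed
  obtain B where B: "finite B" "\<And>b. b \<in> B \<Longrightarrow> is_bracket (PiM J m) \<eta> b"
      "\<And>g. g \<in> signed_monotone A s J \<Longrightarrow> \<exists>b\<in>B. in_bracket (space (PiM J m)) g b"
    using insert.IH[OF \<eta>] by metis
  define glue :: "(nat \<Rightarrow> ('i \<Rightarrow> real) \<Rightarrow> real) \<Rightarrow> ('i \<Rightarrow> real) \<Rightarrow> real"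
    where "glue h x = (\<Sum>k<N0. indicator {t. \<kappa> t = k} (x z) * h k (restrict x J))" for h x
  have glue_eq: "glue h x = h (\<kappa> (x z)) (restrict x J)" for h x
  proof -
    have "glue h x = (\<Sum>k<N0. if \<kappa> (x z) = k then h k (restrict x J) else 0)"
      unfolding glue_def by (intro sum.cong) auto
    then show ?thesis using \<kappa>_less[of "x z"] by simp
  qed
  have glue_meas [measurable]: "glue h \<in> borel_measurable (PiM (insert z J) m)"
    if "\<And>k. k < N0 \<Longrightarrow> h k \<in> borel_measurable (PiM J m)" for h
  proof -
    have [measurable]: "(\<lambda>x. restrict x J) \<in> measurable (PiM (insert z J) m) (PiM J m)"
      by (rule measurable_restrict_subset) auto
    have [measurable]: "(\<lambda>x. x z) \<in> borel_measurable (PiM (insert z J) m)"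
      using measurable_compose[of "\<lambda>x. x z" "PiM (insert z J) m" "m z" "\<lambda>x. x" borel] id[of z] by simp
    show ?thesis unfolding glue_def
      by (intro borel_measurable_sum borel_measurable_times measurable_compose[OF _ that]) auto
  qed
  \<comment> \<open>On each cell the lower function comes from a bracket of the lower envelope and the upper function
    from a bracket of the upper envelope; there are finitely many ways to choose them.\<close>
  define mk where "mk pq = (glue (\<lambda>k. fst (fst pq k)), glue (\<lambda>k. snd (snd pq k)))"
    for pq :: "(nat \<Rightarrow> (('i \<Rightarrow> real) \<Rightarrow> real) \<times> (('i \<Rightarrow> real) \<Rightarrow> real)) \<times> (nat \<Rightarrow> (('i \<Rightarrow> real) \<Rightarrow> real) \<times> (('i \<Rightarrow> real) \<Rightarrow> real))"
  define C where "C = {b. b \<in> mk ` (({..N0} \<rightarrow>\<^sub>E B) \<times> ({..N0} \<rightarrow>\<^sub>E B)) \<and> is_bracket (PiM (insert z J) m) \<delta> b}"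
  show ?case
  proof (intro exI[of _ C] conjI ballI)
    have "finite (mk ` (({..N0} \<rightarrow>\<^sub>E B) \<times> ({..N0} \<rightarrow>\<^sub>E B)))"
      by (intro finite_imageI finite_cartesian_product finite_PiE) (use B(1) in auto)
    then show "finite C" by (rule finite_subset[rotated]) (auto simp: C_def)
    show "is_bracket (PiM (insert z J) m) \<delta> b" if "b \<in> C" for b using that by (simp add: C_def)
    fix g assume g: "g \<in> signed_monotone A s (insert z J)"
    define Glo where "Glo = lower_envelope A \<kappa> z g"
    define Gup where "Gup = upper_envelope A \<kappa> z g"
    note env = cell_envelopes[of z J g A s \<kappa>, OF insert.hyps(2) g \<kappa>_mono, folded Glo_def Gup_def]
    have "\<exists>b\<in>B. in_bracket (space (PiM J m)) (Glo k) b" for k by (rule B(3)) (rule env(1))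
    then obtain p0 where p0: "\<And>k. p0 k \<in> B" "\<And>k. in_bracket (space (PiM J m)) (Glo k) (p0 k)" by metis
    have "\<exists>b\<in>B. in_bracket (space (PiM J m)) (Gup k) b" for k by (rule B(3)) (rule env(2))
    then obtain q0 where q0: "\<And>k. q0 k \<in> B" "\<And>k. in_bracket (space (PiM J m)) (Gup k) (q0 k)" by metis
    \<comment> \<open>A cell of mass above \<open>\<delta> / 4\<close> is an atom. There the two envelopes agree, and using one bracket
      for both makes the atom contribute only the bracket gap \<open>\<eta>\<close>.\<close>
    define q1 where "q1 k = (if w k \<le> \<delta> / 4 then q0 k else p0 k)" for k
    have q1B: "q1 k \<in> B" for k using p0 q0 by (simp add: q1_def)
    have q1: "in_bracket (space (PiM J m)) (Gup k) (q1 k)" for k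
    proof (cases "w k \<le> \<delta> / 4")
      case False
      then obtain t where t: "{x. \<kappa> x = k} = {t}" using cell[of k] by auto
      have "t \<in> A"
      proof (rule ccontr)
        assume "t \<notin> A"
        then have "w k = 0" using t by (simp add: w_def)
        with False insert.prems show False by simp
      qed
      moreover have "\<kappa> t = k" using t by auto
      ultimately have "Gup k x = Glo k x" if "x \<in> J \<rightarrow>\<^sub>E A" for x
        using env(6)[OF that, of t] t by auto
      then show ?thesis using p0(2)[of k] False
        by (auto simp: q1_def in_bracket_def space_J)
    qed (use q0 in \<open>simp add: q1_def\<close>)
    define p where "p = restrict p0 {..N0}"
    define q where "q = restrict q1 {..N0}"
    have pq: "p \<in> {..N0} \<rightarrow>\<^sub>E B" "q \<in> {..N0} \<rightarrow>\<^sub>E B" using p0 q1B by (auto simp: p_def q_def)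
    have pq_eq: "p k = p0 k" "q k = q1 k" if "k < N0" for k using that by (auto simp: p_def q_def)
    have pB: "is_bracket (PiM J m) \<eta> (p0 k)" and qB: "is_bracket (PiM J m) \<eta> (q1 k)" for k
      using p0 q1B B(2) by auto
    have int: "integrable (PiM J m) (fst b)" "integrable (PiM J m) (snd b)"
      if "is_bracket (PiM J m) \<eta> b" for b
    proof -
      have "\<bar>fst b x\<bar> \<le> 1" "\<bar>snd b x\<bar> \<le> 1" if x: "x \<in> space (PiM J m)" for x
      proof -
        have "0 \<le> fst b x" "fst b x \<le> snd b x" "snd b x \<le> 1"
          using \<open>is_bracket (PiM J m) \<eta> b\<close> x by (auto simp: is_bracket_def)
        then show "\<bar>fst b x\<bar> \<le> 1" "\<bar>snd b x\<bar> \<le> 1" by linarith+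
      qed
      with that show "integrable (PiM J m) (fst b)" "integrable (PiM J m) (snd b)"
        unfolding is_bracket_def real_norm_def[symmetric]
        by (blast intro: P.integrable_const_bound[where B = 1] AE_I2)+
    qed
    have inside: "fst (mk (p, q)) x \<le> g x \<and> g x \<le> snd (mk (p, q)) x"
      if x: "x \<in> space (PiM (insert z J) m)" for x
    proof -
      have r: "restrict x J \<in> J \<rightarrow>\<^sub>E A" "x z \<in> A" using x by (auto simp: space_J)
      have "(restrict x J)(z := x z) = x"
        using x by (auto simp: space_J fun_eq_iff PiE_def extensional_def)
      with env(3)[OF r] in_bracketD(1)[OF p0(2), of "restrict x J" "\<kappa> (x z)"]
        in_bracketD(2)[OF q1, of "restrict x J" "\<kappa> (x z)"] r(1)
      have "fst (p0 (\<kappa> (x z))) (restrict x J) \<le> g x \<and> g x \<le> snd (q1 (\<kappa> (x z))) (restrict x J)"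
        by (simp add: space_J)
      then show ?thesis using \<kappa>_less[of "x z"] by (simp add: mk_def glue_eq pq_eq)
    qed
    have meas: "fst (mk (p, q)) \<in> borel_measurable (PiM (insert z J) m)"
      "snd (mk (p, q)) \<in> borel_measurable (PiM (insert z J) m)"
      using pB qB by (auto simp: mk_def pq_eq is_bracket_def intro!: glue_meas)
    have range: "0 \<le> fst (mk (p, q)) x" "snd (mk (p, q)) x \<le> 1"
      if x: "x \<in> space (PiM (insert z J) m)" for x
    proof -
      have r: "restrict x J \<in> space (PiM J m)" using x by (auto simp: space_J)
      with pB[of "\<kappa> (x z)"] qB[of "\<kappa> (x z)"] \<kappa>_less[of "x z"]
      show "0 \<le> fst (mk (p, q)) x" "snd (mk (p, q)) x \<le> 1"
        by (auto simp: mk_def glue_eq pq_eq is_bracket_def)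
    qed
    have "(\<integral>x. snd (mk (p, q)) x - fst (mk (p, q)) x \<partial>PiM (insert z J) m)
        = (\<integral>x. (\<integral>t. snd (mk (p, q)) (x(z := t)) - fst (mk (p, q)) (x(z := t)) \<partial>m z) \<partial>PiM J m)"
    proof (rule product_integral_insert[OF insert.hyps(1,2)])
      show "integrable (PiM (insert z J) m) (\<lambda>x. snd (mk (p, q)) x - fst (mk (p, q)) x)"
      proof (rule P'.integrable_const_bound[where B = 1, OF AE_I2])
        fix x assume x: "x \<in> space (PiM (insert z J) m)"
        show "norm (snd (mk (p, q)) x - fst (mk (p, q)) x) \<le> 1"
          using range[OF x] inside[OF x] by simp
      qed (use meas in measurable)
    qed
    also have "\<dots> = (\<integral>x. (\<Sum>k<N0. w k * (snd (q1 k) x - fst (p0 k) x)) \<partial>PiM J m)"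
    proof (rule Bochner_Integration.integral_cong[OF refl])
      fix x assume "x \<in> space (PiM J m)"
      then have x: "restrict (x(z := t)) J = x" for t
        using insert.hyps(2) by (auto simp: space_J fun_eq_iff PiE_def extensional_def)
      have "snd (mk (p, q)) (x(z := t)) - fst (mk (p, q)) (x(z := t))
          = (\<Sum>k<N0. indicator {t. \<kappa> t = k} t * (snd (q1 k) x - fst (p0 k) x))" for t
        by (simp only: mk_def glue_def x fst_conv snd_conv fun_upd_same sum_subtractf[symmetric]
              right_diff_distrib[symmetric]) (rule sum.cong, simp_all add: pq_eq)
      then have "(\<integral>t. snd (mk (p, q)) (x(z := t)) - fst (mk (p, q)) (x(z := t)) \<partial>m z)
          = (\<integral>t. (\<Sum>k<N0. indicator {t. \<kappa> t = k} t * (snd (q1 k) x - fst (p0 k) x)) \<partial>m z)"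
        by presburger
      also have "\<dots> = (\<Sum>k<N0. (\<integral>t. indicator {t. \<kappa> t = k} t * (snd (q1 k) x - fst (p0 k) x) \<partial>m z))"
        by (intro Bochner_Integration.integral_sum integrable_mult_left
              mz.integrable_const_bound[where B = 1] AE_I2 ind) (auto split: split_indicator)
      also have "\<dots> = (\<Sum>k<N0. w k * (snd (q1 k) x - fst (p0 k) x))"
        by (simp add: w_def space_m)
      finally show "(\<integral>t. snd (mk (p, q)) (x(z := t)) - fst (mk (p, q)) (x(z := t)) \<partial>m z)
        = (\<Sum>k<N0. w k * (snd (q1 k) x - fst (p0 k) x))" .
    qed
    also have "\<dots> = (\<Sum>k<N0. w k * ((\<integral>x. snd (q1 k) x \<partial>PiM J m) - (\<integral>x. fst (p0 k) x \<partial>PiM J m)))"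
      using int[OF pB] int[OF qB] by (subst Bochner_Integration.integral_sum) auto
    also have "\<dots> \<le> real N0 * \<eta> + (\<delta> / 4) * (2 * real N0 * \<eta> + 1)"
    proof (rule telescoping_cell_bound[where \<alpha>' = "\<lambda>k. \<integral>x. fst (q1 k) x \<partial>PiM J m"
          and \<beta> = "\<lambda>k. \<integral>x. snd (p0 k) x \<partial>PiM J m"])
      fix k assume "k < N0"
      show "0 \<le> w k \<and> w k \<le> 1" using w01 by auto
      show "(\<integral>x. snd (q1 k) x \<partial>PiM J m) - (\<integral>x. fst (q1 k) x \<partial>PiM J m) \<le> \<eta>"
        using qB[of k] int[OF qB] by (simp add: is_bracket_def)
      show "(\<integral>x. fst (p0 k) x \<partial>PiM J m) \<le> (\<integral>x. snd (p0 (Suc k)) x \<partial>PiM J m)"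
      proof (intro integral_mono int pB)
        fix x assume "x \<in> space (PiM J m)"
        then show "fst (p0 k) x \<le> snd (p0 (Suc k)) x"
          using in_bracketD[OF p0(2), of x k] in_bracketD[OF p0(2), of x "Suc k"] env(5)[of x k]
          by (simp add: space_J)
      qed
      show "(\<integral>x. fst (q1 k) x \<partial>PiM J m) \<le> (\<integral>x. snd (p0 (Suc k)) x \<partial>PiM J m)"
      proof (intro integral_mono int pB qB)
        fix x assume "x \<in> space (PiM J m)"
        then show "fst (q1 k) x \<le> snd (p0 (Suc k)) x"
          using in_bracketD[OF q1, of x k] in_bracketD[OF p0(2), of x "Suc k"] env(4)[of x k]
          by (simp add: space_J)
      qed
      show "(\<integral>x. snd (q1 k) x \<partial>PiM J m) = (\<integral>x. snd (p0 k) x \<partial>PiM J m)" if "\<not> w k \<le> \<delta> / 4"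
        using that by (simp add: q1_def)
    next
      show "(\<integral>x. snd (p0 k) x \<partial>PiM J m) - (\<integral>x. fst (p0 k) x \<partial>PiM J m) \<le> \<eta>" for k
        using pB[of k] int[OF pB] by (simp add: is_bracket_def)
      show "0 \<le> (\<integral>x. snd (p0 0) x \<partial>PiM J m)"
      proof (intro integral_nonneg_AE AE_I2)
        fix x assume "x \<in> space (PiM J m)"
        then have "0 \<le> fst (p0 0) x" "fst (p0 0) x \<le> snd (p0 0) x"
          using pB[of 0] by (auto simp: is_bracket_def)
        then show "0 \<le> snd (p0 0) x" by linarith
      qed
      show "(\<integral>x. snd (p0 N0) x \<partial>PiM J m) \<le> 1"
        using pB[of N0] int[OF pB] by (intro P.integral_le_const AE_I2) (auto simp: is_bracket_def)
    qed (use insert.prems \<eta> in auto)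
    also have "\<dots> \<le> \<delta> / 4 + (\<delta> / 4) * (2 * 1 + 1)"
      using N\<eta> insert.prems by (intro add_mono mult_left_mono) auto
    also have "\<dots> = \<delta>" by simp
    finally have "is_bracket (PiM (insert z J) m) \<delta> (mk (p, q))"
      unfolding is_bracket_def using meas range order_trans[OF conjunct1[OF inside] conjunct2[OF inside]]
      by blast
    moreover have "in_bracket (space (PiM (insert z J) m)) g (mk (p, q))"
      using inside by (simp add: in_bracket_def)
    ultimately show "\<exists>b\<in>C. in_bracket (space (PiM (insert z J) m)) g b"
      using pq by (intro bexI[of _ "mk (p, q)"]) (auto simp: C_def)
  qed
qed

section \<open>Change of reference measure\<close>

text \<open>
  If this failed, some sequence would tend to zero in \<open>L\<^sup>1(M)\<close> but not in \<open>L\<^sup>1(N)\<close>. A subsequence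
  tends to zero \<open>M\<close>-almost everywhere, hence \<open>N\<close>-almost everywhere, which contradicts dominated
  convergence. This carries small bracket gaps over from a product measure to the law of the configuration.
\<close>

lemma absolutely_continuous_small_integral:
  fixes \<epsilon> :: real
  assumes M: "finite_measure M" and N: "finite_measure N"
    and ac: "absolutely_continuous M N" and sets: "sets N = sets M" and \<epsilon>: "0 < \<epsilon>"
  shows "\<exists>\<delta>>0. \<forall>h\<in>borel_measurable M. (\<forall>x\<in>space M. 0 \<le> h x \<and> h x \<le> 1) \<longrightarrow>
           (\<integral>x. h x \<partial>M) \<le> \<delta> \<longrightarrow> (\<integral>x. h x \<partial>N) \<le> \<epsilon>"
proof (rule ccontr)
  assume neg: "\<not> ?thesis"
  interpret M: finite_measure M by fact
  interpret N: finite_measure N by fact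
  have space: "space N = space M" by (rule sets_eq_imp_space_eq[OF sets])
  have "\<forall>n. \<exists>h. h \<in> borel_measurable M \<and> (\<forall>x\<in>space M. 0 \<le> h x \<and> h x \<le> 1) \<and>
      (\<integral>x. h x \<partial>M) \<le> 1 / real (Suc n) \<and> (\<integral>x. h x \<partial>N) > \<epsilon>"
  proof
    fix n
    have "(0::real) < 1 / real (Suc n)" by simp
    with neg obtain h where "h \<in> borel_measurable M" "\<forall>x\<in>space M. 0 \<le> h x \<and> h x \<le> 1"
      "(\<integral>x. h x \<partial>M) \<le> 1 / real (Suc n)" "\<not> (\<integral>x. h x \<partial>N) \<le> \<epsilon>" by blast
    then show "\<exists>h. h \<in> borel_measurable M \<and> (\<forall>x\<in>space M. 0 \<le> h x \<and> h x \<le> 1) \<and>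
      (\<integral>x. h x \<partial>M) \<le> 1 / real (Suc n) \<and> (\<integral>x. h x \<partial>N) > \<epsilon>" by (intro exI[of _ h]) auto
  qed
  then obtain h where h: "\<And>n. h n \<in> borel_measurable M"
      "\<And>n x. x \<in> space M \<Longrightarrow> 0 \<le> h n x \<and> h n x \<le> 1"
      "\<And>n. (\<integral>x. h n x \<partial>M) \<le> 1 / real (Suc n)" "\<And>n. (\<integral>x. h n x \<partial>N) > \<epsilon>"
    by metis
  have int: "integrable M (h n)" for n
    using h(1,2) by (intro M.integrable_const_bound[where B = 1] AE_I2) auto
  have "(\<lambda>n. \<integral>x. norm (h n x) \<partial>M) \<longlonglongrightarrow> 0"
  proof (rule tendsto_sandwich[OF _ _ tendsto_const])
    show "\<forall>\<^sub>F n in sequentially. (\<integral>x. norm (h n x) \<partial>M) \<le> 1 / real (Suc n)"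
    proof (intro always_eventually allI)
      fix n
      have "(\<integral>x. norm (h n x) \<partial>M) = (\<integral>x. h n x \<partial>M)"
        by (rule Bochner_Integration.integral_cong) (use h(2) in auto)
      then show "(\<integral>x. norm (h n x) \<partial>M) \<le> 1 / real (Suc n)" using h(3) by simp
    qed
    show "(\<lambda>n. 1 / real (Suc n)) \<longlonglongrightarrow> 0" by (rule LIMSEQ_Suc) (rule lim_1_over_n)
  qed auto
  from tendsto_L1_AE_subseq[OF int this] obtain \<phi> where
    \<phi>: "strict_mono \<phi>" "AE x in M. (\<lambda>n. h (\<phi> n) x) \<longlonglongrightarrow> 0" by blast
  have "AE x in N. (\<lambda>n. h (\<phi> n) x) \<longlonglongrightarrow> 0"
    using absolutely_continuous_AE[OF sets ac \<phi>(2)] .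
  then have "(\<lambda>n. \<integral>x. h (\<phi> n) x \<partial>N) \<longlonglongrightarrow> (\<integral>x. 0 \<partial>N)"
    using h(1,2) sets space
    by (intro integral_dominated_convergence[where w = "\<lambda>_. 1"])
       (auto simp: measurable_cong_sets[OF sets refl])
  then have "\<epsilon> \<le> 0" using h(4) by (intro tendsto_lowerbound[of _ 0 sequentially \<epsilon>])
      (auto intro!: always_eventually less_imp_le)
  with \<epsilon> show False by simp
qed

text \<open>
  Each factor is multiplied by a strictly positive integrable density. The product of these densities
  is strictly positive as well, so the products have the same null sets.
\<close>

lemma equivalent_probability_product:
  fixes \<mu> :: "'i \<Rightarrow> 'a measure"
  assumes sf: "\<And>i. sigma_finite_measure (\<mu> i)" and ne: "\<And>i. emeasure (\<mu> i) (space (\<mu> i)) \<noteq> 0"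
  obtains m where "\<And>i. prob_space (m i)" "\<And>i. sets (m i) = sets (\<mu> i)"
    "\<And>J. finite J \<Longrightarrow> absolutely_continuous (PiM J m) (PiM J \<mu>)"
proof -
  have "\<exists>h::'a \<Rightarrow> real. h \<in> borel_measurable (\<mu> i) \<and> (\<forall>x. 0 < h x) \<and> integrable (\<mu> i) h" for i
    by (rule sigma_finite_measure.obtain_positive_integrable_function[OF sf[of i]]) blast
  then obtain h :: "'i \<Rightarrow> 'a \<Rightarrow> real" where h [measurable]: "\<And>i. h i \<in> borel_measurable (\<mu> i)"
    and h_pos: "\<And>i x. 0 < h i x" and h_int: "\<And>i. integrable (\<mu> i) (h i)" by metis
  define c where "c i = (\<integral>x. h i x \<partial>\<mu> i)" for i
  have c: "0 < c i" for i
  proof -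
    have "c i \<noteq> 0"
    proof
      assume "c i = 0"
      then have "AE x in \<mu> i. h i x = 0"
        using integral_nonneg_eq_0_iff_AE[OF h_int[of i]] h_pos[of i] by (auto simp: c_def less_imp_le)
      then have "AE x in \<mu> i. False"
        by (rule AE_mp) (use h_pos[of i] in \<open>auto intro!: AE_I2 simp: less_le\<close>)
      then show False using ne[of i] AE_iff_measurable[OF sets.top, of "\<mu> i" "\<lambda>_. False"] by simp
    qed
    moreover have "0 \<le> c i" unfolding c_def using h_pos by (intro integral_nonneg_AE AE_I2 less_imp_le)
    ultimately show ?thesis by simp
  qed
  define g where "g i x = h i x / c i" for i x
  have g [measurable]: "g i \<in> borel_measurable (\<mu> i)" for i unfolding g_def by measurable
  have g_pos: "0 < g i x" for i x using h_pos c by (simp add: g_def)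
  define m where "m i = density (\<mu> i) (\<lambda>x. ennreal (g i x))" for i
  have sets_m [simp, measurable_cong]: "sets (m i) = sets (\<mu> i)" for i by (simp add: m_def)
  have prob: "prob_space (m i)" for i
  proof
    have "emeasure (m i) (space (m i)) = (\<integral>\<^sup>+x. ennreal (g i x) \<partial>\<mu> i)"
      by (simp add: m_def emeasure_density cong: nn_integral_cong)
    also have "\<dots> = ennreal (\<integral>x. g i x \<partial>\<mu> i)"
      using h_int[of i] g_pos by (intro nn_integral_eq_integral) (auto simp: g_def less_imp_le)
    also have "(\<integral>x. g i x \<partial>\<mu> i) = 1" using c[of i] by (simp add: g_def c_def)
    finally show "emeasure (m i) (space (m i)) = 1" by simp
  qed
  interpret \<mu>: product_sigma_finite \<mu> by (simp add: product_sigma_finite_def sf)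
  interpret m: product_sigma_finite m
    by (simp add: product_sigma_finite_def prob prob_space_imp_sigma_finite)
  have ac: "absolutely_continuous (PiM J m) (PiM J \<mu>)" if J: "finite J" for J
  proof -
    let ?G = "\<lambda>x. \<Prod>i\<in>J. ennreal (g i (x i))"
    have G [measurable]: "?G \<in> borel_measurable (PiM J \<mu>)" by measurable
    have G_pos: "?G x \<noteq> 0" for x
    proof -
      have "?G x = ennreal (\<Prod>i\<in>J. g i (x i))" using g_pos by (intro prod_ennreal) (auto simp: less_imp_le)
      moreover have "0 < (\<Prod>i\<in>J. g i (x i))" using g_pos by (intro prod_pos) auto
      ultimately show ?thesis by (simp add: ennreal_eq_0_iff not_le)
    qed
    have eq: "density (PiM J \<mu>) ?G = PiM J m"
    proof (rule m.PiM_eqI[OF J])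
      show "sets (density (PiM J \<mu>) ?G) = sets (PiM J m)" by (simp cong: sets_PiM_cong)
      fix S assume "\<And>i. i \<in> J \<Longrightarrow> S i \<in> sets (m i)"
      then have S [measurable]: "\<And>i. i \<in> J \<Longrightarrow> S i \<in> sets (\<mu> i)" by simp
      have "emeasure (density (PiM J \<mu>) ?G) (Pi\<^sub>E J S) = (\<integral>\<^sup>+x. ?G x * indicator (Pi\<^sub>E J S) x \<partial>PiM J \<mu>)"
        using J S by (intro emeasure_density G sets_PiM_I_finite) auto
      also have "\<dots> = (\<integral>\<^sup>+x. (\<Prod>i\<in>J. ennreal (g i (x i)) * indicator (S i) (x i)) \<partial>PiM J \<mu>)"
      proof (rule nn_integral_cong)
        fix x assume "x \<in> space (PiM J \<mu>)"
        then have "x \<in> extensional J" by (simp add: space_PiM PiE_def)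
        then have "indicator (Pi\<^sub>E J S) x = (\<Prod>i\<in>J. indicator (S i) (x i) :: ennreal)"
          using J by (auto simp: indicator_def PiE_def Pi_def)
        then show "?G x * indicator (Pi\<^sub>E J S) x = (\<Prod>i\<in>J. ennreal (g i (x i)) * indicator (S i) (x i))"
          by (simp add: prod.distrib)
      qed
      also have "\<dots> = (\<Prod>i\<in>J. \<integral>\<^sup>+x. ennreal (g i x) * indicator (S i) x \<partial>\<mu> i)"
        using J by (intro \<mu>.product_nn_integral_prod) auto
      also have "\<dots> = (\<Prod>i\<in>J. emeasure (m i) (S i))"
        by (intro prod.cong refl) (simp add: m_def emeasure_density S)
      finally show "emeasure (density (PiM J \<mu>) ?G) (Pi\<^sub>E J S) = (\<Prod>i\<in>J. emeasure (m i) (S i))" .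
    qed
    show ?thesis unfolding absolutely_continuous_def eq[symmetric]
    proof
      fix N assume "N \<in> null_sets (density (PiM J \<mu>) ?G)"
      then have "N \<in> sets (PiM J \<mu>)" "AE x in PiM J \<mu>. x \<in> N \<longrightarrow> ?G x = 0"
        by (auto simp: null_sets_density_iff[OF G])
      with G_pos show "N \<in> null_sets (PiM J \<mu>)"
        by (subst AE_iff_null_sets) (auto elim: eventually_mono)
    qed
  qed
  show thesis by (rule that[of m]) (use prob ac in auto)
qed

section \<open>Averages of independent bounded variables\<close>

text \<open>
  A strong law of large numbers along growing finite index sets. Boundedness gives exponential tails by
  Hoeffding's inequality, so a lower bound \<open>k \<le> card (J k)\<close> already makes them summable.
\<close>

lemma (in prob_space) bounded_independent_averages:
  fixes Z :: "'j \<Rightarrow> 'a \<Rightarrow> real" and J :: "nat \<Rightarrow> 'j set"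
  assumes J: "\<And>k. finite (J k)" "\<And>k. k \<le> card (J k)"
    and indep: "\<And>k. 0 < k \<Longrightarrow> indep_vars (\<lambda>_. borel) Z (J k)"
    and Z01: "\<And>j \<omega>. \<omega> \<in> space M \<Longrightarrow> 0 \<le> Z j \<omega> \<and> Z j \<omega> \<le> 1"
    and mean: "\<And>j. expectation (Z j) = c" and \<epsilon>: "0 < \<epsilon>"
  shows "AE \<omega> in M. \<forall>\<^sub>F k in sequentially. \<bar>(\<Sum>j\<in>J k. Z j \<omega>) / real (card (J k)) - c\<bar> \<le> \<epsilon>"
proof -
  define a where "a = exp (- 2 * \<epsilon>\<^sup>2)"
  have a: "0 < a" "a < 1" using \<epsilon> by (auto simp: a_def)
  have rv: "random_variable borel (Z j)" if "j \<in> J k" "0 < k" for j k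
    using indep[OF that(2)] that(1) by (auto simp: indep_vars_def)
  define S where "S k = {\<omega> \<in> space M. \<epsilon> * real (card (J (Suc k))) \<le>
      \<bar>(\<Sum>j\<in>J (Suc k). Z j \<omega>) - c * real (card (J (Suc k)))\<bar>}" for k
  have S: "S k \<in> events" for k
  proof -
    have "(\<lambda>\<omega>. \<Sum>j\<in>J (Suc k). Z j \<omega>) \<in> borel_measurable M"
      by (rule borel_measurable_sum) (use rv in blast)
    then show ?thesis unfolding S_def by measurable
  qed
  have "prob (S k) \<le> 2 * a ^ Suc k" for k
  proof -
    let ?N = "real (card (J (Suc k)))"
    have N: "real (Suc k) \<le> ?N" using J(2)[of "Suc k"] by (simp only: of_nat_le_iff)
    interpret H: Hoeffding_ineq M "J (Suc k)" Z "\<lambda>_. 0" "\<lambda>_. 1" "\<Sum>i\<in>J (Suc k). expectation (Z i)"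
      by unfold_locales (use J(1) indep[of "Suc k"] Z01 in auto)
    have "prob {\<omega> \<in> space M. \<epsilon> * ?N \<le> \<bar>(\<Sum>i\<in>J (Suc k). Z i \<omega>) - (\<Sum>i\<in>J (Suc k). expectation (Z i))\<bar>}
        \<le> 2 * exp (- 2 * (\<epsilon> * ?N)\<^sup>2 / (\<Sum>i\<in>J (Suc k). (1 - 0)\<^sup>2))"
      by (rule H.Hoeffding_ineq_abs_ge) (use \<epsilon> N in auto)
    also have "{\<omega> \<in> space M. \<epsilon> * ?N \<le> \<bar>(\<Sum>i\<in>J (Suc k). Z i \<omega>) - (\<Sum>i\<in>J (Suc k). expectation (Z i))\<bar>} = S k"
      by (simp add: S_def mean mult.commute)
    also have "- 2 * (\<epsilon> * ?N)\<^sup>2 / (\<Sum>i\<in>J (Suc k). (1 - 0)\<^sup>2) = ?N * (- 2 * \<epsilon>\<^sup>2)"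
      using N by (simp add: power2_eq_square field_simps)
    also have "exp (?N * (- 2 * \<epsilon>\<^sup>2)) = a ^ card (J (Suc k))"
      unfolding a_def by (simp only: exp_of_nat_mult)
    also have "\<dots> \<le> a ^ Suc k" using a J(2)[of "Suc k"] by (intro power_decreasing) auto
    finally show ?thesis by simp
  qed
  \<comment> \<open>Hoeffding's bound decays exponentially in \<open>card (J k) \<ge> k\<close>, so Borel-Cantelli applies.\<close>
  then have bound: "norm (prob (S k)) \<le> 2 * a ^ Suc k" for k by (simp only: real_norm_def abs_of_nonneg measure_nonneg)
  have "summable (\<lambda>k. a ^ Suc k)"
    using a by (intro summable_Suc_iff[of "\<lambda>k. a ^ k", THEN iffD2] summable_geometric) simp
  then have sumb: "summable (\<lambda>k. prob (S k))"
    by (intro summable_comparison_test'[OF summable_mult bound])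
  have "AE \<omega> in M. \<forall>\<^sub>F k in sequentially. \<omega> \<in> space M - S k"
    by (rule borel_cantelli_AE1[OF S _ sumb]) (simp add: emeasure_eq_measure)
  then show ?thesis
  proof (rule AE_mp, intro AE_I2 impI)
    fix \<omega> assume \<omega>: "\<omega> \<in> space M" "\<forall>\<^sub>F k in sequentially. \<omega> \<in> space M - S k"
    have "\<forall>\<^sub>F k in sequentially. \<bar>(\<Sum>j\<in>J (Suc k). Z j \<omega>) / real (card (J (Suc k))) - c\<bar> \<le> \<epsilon>"
      using \<omega>(2)
    proof eventually_elim
      case (elim k)
      let ?N = "real (card (J (Suc k)))"
      have N: "0 < ?N" using J(2)[of "Suc k"] by simp
      have "\<bar>(\<Sum>j\<in>J (Suc k). Z j \<omega>) - c * ?N\<bar> \<le> \<epsilon> * ?N"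
        using elim \<omega>(1) by (auto simp: S_def)
      moreover have "(\<Sum>j\<in>J (Suc k). Z j \<omega>) / ?N - c = ((\<Sum>j\<in>J (Suc k). Z j \<omega>) - c * ?N) / ?N"
        using N by (simp add: field_simps)
      ultimately show ?case using N by (simp add: abs_divide pos_divide_le_eq)
    qed
    then show "\<forall>\<^sub>F k in sequentially. \<bar>(\<Sum>j\<in>J k. Z j \<omega>) / real (card (J k)) - c\<bar> \<le> \<epsilon>"
      by (rule eventually_sequentially_Suc[THEN iffD1,
            of "\<lambda>k. \<bar>(\<Sum>j\<in>J k. Z j \<omega>) / real (card (J k)) - c\<bar> \<le> \<epsilon>"])
  qed
qed

section \<open>Lattice boxes, tiles and shifts\<close>

lemma l1_dist_self [simp]: "l1_dist x x = 0"
  by (simp add: l1_dist_def)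

lemma lattice_box_image: "(lattice_box n :: 'd::finite lattice set) = vec_lambda ` (UNIV \<rightarrow>\<^sub>E {0..<int n})"
proof (intro set_eqI iffI)
  fix x :: "'d lattice" assume "x \<in> lattice_box n"
  then have "vec_nth x \<in> UNIV \<rightarrow>\<^sub>E {0..<int n}" by (simp add: lattice_box_def PiE_iff)
  then have "vec_lambda (vec_nth x) \<in> vec_lambda ` (UNIV \<rightarrow>\<^sub>E {0..<int n})" by (rule imageI)
  then show "x \<in> vec_lambda ` (UNIV \<rightarrow>\<^sub>E {0..<int n})" by simp
qed (auto simp: lattice_box_def PiE_iff)

lemma finite_lattice_box [simp]: "finite (lattice_box n)"
  unfolding lattice_box_image by (intro finite_imageI finite_PiE) auto

lemma card_lattice_box: "card (lattice_box n :: 'd::finite lattice set) = n ^ CARD('d)"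
proof -
  have "inj_on vec_lambda (UNIV \<rightarrow>\<^sub>E {0..<int n} :: ('d \<Rightarrow> int) set)"
    by (rule inj_on_inverseI[where g = vec_nth]) (simp add: fun_eq_iff)
  then show ?thesis unfolding lattice_box_image by (simp add: card_image card_PiE)
qed

definition tile_shift :: "nat \<Rightarrow> 'd::finite lattice \<Rightarrow> 'd lattice" where
  "tile_shift q j = (\<chi> i. int q * j $ i)"

text \<open>
  Tiles have side \<open>m\<close> and period \<open>m + r\<close>, so points of different tiles are at distance at least
  \<open>r + 1\<close> along some axis.
\<close>

lemma tiles_separated:
  fixes i j :: "'d::finite lattice"
  assumes "i \<noteq> j" "x \<in> translate (lattice_box m) (tile_shift (m + r) i)"
    "y \<in> translate (lattice_box m) (tile_shift (m + r) j)"
  shows "int r < l1_dist x y"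
proof -
  obtain a where a: "i $ a \<noteq> j $ a" using assms(1) by (auto simp: vec_eq_iff)
  obtain u v where u: "u \<in> lattice_box m" "x = u + tile_shift (m + r) i"
    and v: "v \<in> lattice_box m" "y = v + tile_shift (m + r) j"
    using assms(2,3) by (auto simp: translate_def)
  have uv: "\<bar>u $ a - v $ a\<bar> < int m"
  proof -
    have "0 \<le> u $ a" "u $ a < int m" "0 \<le> v $ a" "v $ a < int m" using u(1) v(1) by (auto simp: lattice_box_def)
    then show ?thesis by linarith
  qed
  have "int (m + r) * 1 \<le> int (m + r) * \<bar>i $ a - j $ a\<bar>" using a by (intro mult_left_mono) auto
  also have "\<dots> = \<bar>int (m + r) * i $ a - int (m + r) * j $ a\<bar>" by (simp add: abs_mult flip: right_diff_distrib)
  finally have "int r < \<bar>x $ a - y $ a\<bar>" using uv unfolding u(2) v(2) tile_shift_def by simp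
  also have "\<dots> \<le> l1_dist x y" unfolding l1_dist_def
    by (rule member_le_sum[where f = "\<lambda>a. \<bar>x $ a - y $ a\<bar>"]) auto
  finally show ?thesis .
qed

lemma zero_in_lattice_box: "0 < m \<Longrightarrow> 0 \<in> lattice_box m"
  by (simp add: lattice_box_def)

lemma shift_config_measurable:
  "shift_config z \<in> measurable (config_space A UNIV) (config_space A UNIV)"
proof -
  have "(\<lambda>\<omega>. \<lambda>x\<in>UNIV. \<omega> (x + z)) \<in> measurable (config_space A UNIV) (config_space A UNIV)"
    unfolding config_space_def by (rule measurable_restrict) (rule measurable_component_singleton, simp)
  moreover have "(\<lambda>\<omega>. \<lambda>x\<in>UNIV. \<omega> (x + z)) = shift_config z"
    by (simp add: fun_eq_iff shift_config_def)
  ultimately show ?thesis by simp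
qed

section \<open>Independence of separated blocks\<close>

text \<open>
  Tonelli for blocks of coordinates instead of single coordinates.
\<close>

lemma (in product_sigma_finite) nn_integral_prod_blocks:
  fixes \<phi> :: "'j \<Rightarrow> ('i \<Rightarrow> 'a) \<Rightarrow> ennreal"
  assumes "finite F" "\<And>j. j \<in> F \<Longrightarrow> finite (K j)" "disjoint_family_on K F"
    "\<And>j. j \<in> F \<Longrightarrow> \<phi> j \<in> borel_measurable (PiM (K j) M)"
  shows "(\<integral>\<^sup>+x. (\<Prod>j\<in>F. \<phi> j (restrict x (K j))) \<partial>PiM (\<Union>j\<in>F. K j) M)
       = (\<Prod>j\<in>F. \<integral>\<^sup>+x. \<phi> j x \<partial>PiM (K j) M)"
  using assms
proof (induction F rule: finite_induct)
  case empty
  show ?case by (simp add: nn_integral_empty space_PiM)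
next
  case (insert j F)
  let ?U = "\<Union>j\<in>F. K j"
  have fin: "finite (K j)" "finite ?U" using insert by auto
  have disj: "K j \<inter> ?U = {}"
    using insert.prems(2) insert.hyps(2) by (auto simp: disjoint_family_on_def)
  have "disjoint_family_on K F" using insert.prems(2) by (auto simp: disjoint_family_on_def)
  note IH = insert.IH[OF insert.prems(1) this insert.prems(3)]
  have meas: "(\<lambda>x. \<phi> i (restrict x (K i))) \<in> borel_measurable (PiM V M)"
    if "i \<in> insert j F" "K i \<subseteq> V" for i V
    by (rule measurable_compose[OF measurable_restrict_subset insert.prems(3)]) (use that in auto)
  have "(\<integral>\<^sup>+x. (\<Prod>i\<in>insert j F. \<phi> i (restrict x (K i))) \<partial>PiM (\<Union>j\<in>insert j F. K j) M)
      = (\<integral>\<^sup>+x. (\<Prod>i\<in>insert j F. \<phi> i (restrict x (K i))) \<partial>PiM (K j \<union> ?U) M)" by simp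
  also have "\<dots> = (\<integral>\<^sup>+x. (\<integral>\<^sup>+y. (\<Prod>i\<in>insert j F. \<phi> i (restrict (merge (K j) ?U (x, y)) (K i))) \<partial>PiM ?U M) \<partial>PiM (K j) M)"
    by (rule product_nn_integral_fold[OF disj fin]) (intro borel_measurable_prod_ennreal meas, auto)
  also have "\<dots> = (\<integral>\<^sup>+x. (\<integral>\<^sup>+y. \<phi> j x * (\<Prod>i\<in>F. \<phi> i (restrict y (K i))) \<partial>PiM ?U M) \<partial>PiM (K j) M)"
  proof (intro nn_integral_cong)
    fix x y assume x: "x \<in> space (PiM (K j) M)" and y: "y \<in> space (PiM ?U M)"
    have "restrict (merge (K j) ?U (x, y)) (K j) = x"
      using x by (auto simp: space_PiM PiE_def extensional_def fun_eq_iff merge_def)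
    moreover have "restrict (merge (K j) ?U (x, y)) (K i) = restrict y (K i)" if "i \<in> F" for i
      using that disj by (auto simp: fun_eq_iff merge_def)
    ultimately show "(\<Prod>i\<in>insert j F. \<phi> i (restrict (merge (K j) ?U (x, y)) (K i)))
        = \<phi> j x * (\<Prod>i\<in>F. \<phi> i (restrict y (K i)))"
      using insert.hyps by simp
  qed
  also have "\<dots> = (\<integral>\<^sup>+x. \<phi> j x * (\<Prod>i\<in>F. \<integral>\<^sup>+x. \<phi> i x \<partial>PiM (K i) M) \<partial>PiM (K j) M)"
    by (subst nn_integral_cmult) (auto intro!: borel_measurable_prod_ennreal meas simp: IH)
  also have "\<dots> = (\<Prod>i\<in>insert j F. \<integral>\<^sup>+x. \<phi> i x \<partial>PiM (K i) M)"
    using insert.hyps insert.prems(3) by (subst nn_integral_multc) auto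
  finally show ?case .
qed

lemma less_set_l1_dist_iff:
  assumes "finite \<Lambda>1" "finite \<Lambda>2" "\<Lambda>1 \<noteq> {}" "\<Lambda>2 \<noteq> {}"
  shows "c < set_l1_dist \<Lambda>1 \<Lambda>2 \<longleftrightarrow> (\<forall>x\<in>\<Lambda>1. \<forall>y\<in>\<Lambda>2. c < l1_dist x y)"
proof -
  have eq: "{l1_dist x y | x y. x \<in> \<Lambda>1 \<and> y \<in> \<Lambda>2} = (\<lambda>(x, y). l1_dist x y) ` (\<Lambda>1 \<times> \<Lambda>2)" by auto
  show ?thesis unfolding set_l1_dist_def eq using assms by (subst Min_gr_iff) auto
qed

lemma sets_PiM_M2:
  assumes "M2 A P \<mu>"
  shows "sets (PiM \<Lambda> \<mu>) = sets (config_space A \<Lambda>)"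
  unfolding config_space_def using assms by (intro sets_PiM_cong) (auto simp: M2_def)

lemma restrict_measurable_config:
  assumes "sets P = sets (config_space A UNIV)"
  shows "(\<lambda>\<omega>. restrict \<omega> \<Lambda>) \<in> measurable P (config_space A \<Lambda>)"
  unfolding measurable_cong_sets[OF assms refl] unfolding config_space_def
  by (rule measurable_restrict_subset) simp

lemma prob_space_marginal:
  assumes "prob_space P" "sets P = sets (config_space A UNIV)"
  shows "prob_space (marginal A P \<Lambda>)"
  unfolding marginal_def by (rule prob_space.prob_space_distr) (use assms restrict_measurable_config in auto)

text \<open>
  The density is a Radon-Nikodym derivative, which represents the marginal because of (M2).
\<close>

lemma density_marginal_density:
  assumes "M2 A P \<mu>" "finite \<Lambda>"
  shows "density (PiM \<Lambda> \<mu>) (marginal_density A P \<mu> \<Lambda>) = marginal A P \<Lambda>"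
proof -
  interpret product_sigma_finite \<mu> using assms(1) by (simp add: product_sigma_finite_def M2_def)
  interpret finite_product_sigma_finite \<mu> \<Lambda> by standard fact
  show ?thesis unfolding marginal_density_def
  proof (rule density_RN_deriv)
    show "absolutely_continuous (PiM \<Lambda> \<mu>) (marginal A P \<Lambda>)" using assms by (simp add: M2_def)
    show "sets (marginal A P \<Lambda>) = sets (PiM \<Lambda> \<mu>)" using sets_PiM_M2[OF assms(1)] by (simp add: marginal_def)
  qed
qed

text \<open>
  By (M3) the joint density of separated blocks is the product of the block densities, and Tonelli
  turns this into the product formula for the probabilities.
\<close>

lemma indep_vars_separated_blocks:
  fixes K :: "'j \<Rightarrow> 'd::finite lattice set"
  assumes P: "prob_space P" and sets: "sets P = sets (config_space A UNIV)"
    and M2: "M2 A P \<mu>" and M3: "M3 A P \<mu> r"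
    and F: "finite F" "F \<noteq> {}" and K: "\<And>j. j \<in> F \<Longrightarrow> finite (K j) \<and> K j \<noteq> {}"
    and sep: "\<And>i j. i \<in> F \<Longrightarrow> j \<in> F \<Longrightarrow> i \<noteq> j \<Longrightarrow> int r < set_l1_dist (K i) (K j)"
  shows "prob_space.indep_vars P (\<lambda>j. config_space A (K j)) (\<lambda>j \<omega>. restrict \<omega> (K j)) F"
proof -
  interpret prob_space P by (rule P)
  interpret product_sigma_finite \<mu> using M2 by (simp add: product_sigma_finite_def M2_def)
  let ?U = "\<Union>j\<in>F. K j"
  note setsU = sets_PiM_M2[OF M2]
  have disj: "disjoint_family_on K F"
    unfolding disjoint_family_on_def
  proof (intro ballI impI, rule ccontr)
    fix i j assume ij: "i \<in> F" "j \<in> F" "i \<noteq> j" and "K i \<inter> K j \<noteq> {}"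
    then obtain x where "x \<in> K i" "x \<in> K j" by auto
    then have "int r < l1_dist x x"
      using less_set_l1_dist_iff[of "K i" "K j" "int r"] sep[OF ij] K[OF ij(1)] K[OF ij(2)] by blast
    then show False by simp
  qed
  have factor: "AE x in PiM ?U \<mu>. marginal_density A P \<mu> ?U x =
      (\<Prod>j\<in>F. marginal_density A P \<mu> (K j) (restrict x (K j)))"
  proof -
    obtain h where h: "bij_betw h {1..card F} F" using ex_bij_betw_nat_finite_1[OF F(1)] by blast
    have hF: "h i \<in> F" if "i \<in> {1..card F}" for i using bij_betwE[OF h] that by blast
    have inj: "h i \<noteq> h j" if "i \<in> {1..card F}" "j \<in> {1..card F}" "i \<noteq> j" for i j
      using inj_on_eq_iff[OF bij_betw_imp_inj_on[OF h]] that by blast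
    have n: "1 \<le> card F" using F by (simp add: Suc_le_eq card_gt_0_iff)
    have "AE x in PiM (\<Union>j\<in>{1..card F}. K (h j)) \<mu>.
        marginal_density A P \<mu> (\<Union>j\<in>{1..card F}. K (h j)) x =
        (\<Prod>j\<in>{1..card F}. marginal_density A P \<mu> (K (h j)) (restrict x (K (h j))))"
    proof (rule M3[unfolded M3_def, THEN spec, of "card F", THEN spec, of "\<lambda>j. K (h j)", THEN mp, THEN mp, THEN mp])
      show "\<forall>i\<in>{1..card F}. \<forall>j\<in>{1..card F}. i \<noteq> j \<longrightarrow> int r < set_l1_dist (K (h i)) (K (h j))"
        using sep hF inj by blast
    qed (use n K hF in blast)+
    moreover have "(\<Union>j\<in>{1..card F}. K (h j)) = ?U"
      by (subst (2) bij_betw_imp_surj_on[OF h, symmetric]) (simp only: image_image)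
    moreover have "(\<Prod>j\<in>{1..card F}. marginal_density A P \<mu> (K (h j)) (restrict x (K (h j)))) =
        (\<Prod>j\<in>F. marginal_density A P \<mu> (K j) (restrict x (K j)))" for x
      by (rule prod.reindex_bij_betw[OF h])
    ultimately show ?thesis by (simp only:)
  qed
  have meas: "marginal_density A P \<mu> \<Lambda> \<in> borel_measurable (PiM \<Lambda> \<mu>)" for \<Lambda>
    by (simp add: marginal_density_def)
  have emeas: "emeasure (marginal A P (K j)) B = (\<integral>\<^sup>+x. marginal_density A P \<mu> (K j) x * indicator B x \<partial>PiM (K j) \<mu>)"
    if "j \<in> F" "B \<in> sets (config_space A (K j))" for j B
  proof -
    have "finite (K j)" using K that by auto
    note density_marginal_density[OF M2 this, symmetric]
    then show ?thesis using that setsU by (simp add: emeasure_density[OF meas])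
  qed
  have fubini: "emeasure P (\<Inter>j\<in>F. (\<lambda>\<omega>. restrict \<omega> (K j)) -` B j \<inter> space P) =
      (\<Prod>j\<in>F. emeasure P ((\<lambda>\<omega>. restrict \<omega> (K j)) -` B j \<inter> space P))"
    if B: "\<And>j. j \<in> F \<Longrightarrow> B j \<in> sets (config_space A (K j))" for B
  proof -
    define D where "D = {x \<in> space (config_space A ?U). \<forall>j\<in>F. restrict x (K j) \<in> B j}"
    have D: "D \<in> sets (config_space A ?U)"
    proof -
      have "{x \<in> space (config_space A ?U). restrict x (K j) \<in> B j} \<in> sets (config_space A ?U)" if "j \<in> F" for j
      proof -
        have "(\<lambda>x. restrict x (K j)) \<in> measurable (config_space A ?U) (config_space A (K j))"
          unfolding config_space_def by (rule measurable_restrict_subset) (use that in auto)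
        from measurable_sets[OF this B[OF that]] show ?thesis
          by (simp add: vimage_def Int_def conj_commute)
      qed
      then show ?thesis unfolding D_def by (intro sets.sets_Collect_finite_All F)
    qed
    have restr: "restrict (restrict \<omega> ?U) (K j) = restrict \<omega> (K j)" if "j \<in> F" for \<omega> :: "'d lattice \<Rightarrow> real" and j
      using that by (auto simp: fun_eq_iff)
    have "(\<Inter>j\<in>F. (\<lambda>\<omega>. restrict \<omega> (K j)) -` B j \<inter> space P) = (\<lambda>\<omega>. restrict \<omega> ?U) -` D \<inter> space P"
      using F(2) restr measurable_space[OF restrict_measurable_config[OF sets]] by (auto simp: D_def)
    then have "emeasure P (\<Inter>j\<in>F. (\<lambda>\<omega>. restrict \<omega> (K j)) -` B j \<inter> space P) = emeasure (marginal A P ?U) D"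
      unfolding marginal_def using D by (simp add: emeasure_distr[OF restrict_measurable_config[OF sets]])
    also have "\<dots> = (\<integral>\<^sup>+x. marginal_density A P \<mu> ?U x * indicator D x \<partial>PiM ?U \<mu>)"
    proof -
      have "finite ?U" using F K by auto
      note density_marginal_density[OF M2 this, symmetric]
      then show ?thesis using D setsU by (simp add: emeasure_density[OF meas])
    qed
    also have "\<dots> = (\<integral>\<^sup>+x. (\<Prod>j\<in>F. marginal_density A P \<mu> (K j) (restrict x (K j)) *
        indicator (B j) (restrict x (K j))) \<partial>PiM ?U \<mu>)"
    proof (rule nn_integral_cong_AE, rule AE_mp[OF factor], intro AE_I2 impI)
      fix x assume "x \<in> space (PiM ?U \<mu>)"
      then have "x \<in> space (config_space A ?U)" by (simp add: sets_eq_imp_space_eq[OF setsU])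
      then have ind: "indicator D x = (\<Prod>j\<in>F. indicator (B j) (restrict x (K j)) :: ennreal)"
        using F(1) by (auto simp: D_def indicator_def)
      assume "marginal_density A P \<mu> ?U x = (\<Prod>j\<in>F. marginal_density A P \<mu> (K j) (restrict x (K j)))"
      then show "marginal_density A P \<mu> ?U x * indicator D x =
          (\<Prod>j\<in>F. marginal_density A P \<mu> (K j) (restrict x (K j)) * indicator (B j) (restrict x (K j)))"
        by (simp only: ind prod.distrib)
    qed
    also have "\<dots> = (\<Prod>j\<in>F. \<integral>\<^sup>+x. marginal_density A P \<mu> (K j) x * indicator (B j) x \<partial>PiM (K j) \<mu>)"
      by (rule nn_integral_prod_blocks[OF F(1) _ disj])
         (use K B setsU meas in \<open>auto intro!: borel_measurable_times_ennreal borel_measurable_indicator\<close>)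
    also have "\<dots> = (\<Prod>j\<in>F. emeasure P ((\<lambda>\<omega>. restrict \<omega> (K j)) -` B j \<inter> space P))"
    proof (rule prod.cong[OF refl])
      fix j assume j: "j \<in> F"
      have "emeasure P ((\<lambda>\<omega>. restrict \<omega> (K j)) -` B j \<inter> space P) = emeasure (marginal A P (K j)) (B j)"
        unfolding marginal_def using B[OF j] by (simp add: emeasure_distr[OF restrict_measurable_config[OF sets]])
      with emeas[OF j B[OF j]]
      show "(\<integral>\<^sup>+x. marginal_density A P \<mu> (K j) x * indicator (B j) x \<partial>PiM (K j) \<mu>) =
        emeasure P ((\<lambda>\<omega>. restrict \<omega> (K j)) -` B j \<inter> space P)" by simp
    qed
    finally show ?thesis .
  qed
  show ?thesis
  proof (subst indep_vars_finite[where E = "\<lambda>j. sets (config_space A (K j))", OF F(2,1)])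
    show "\<forall>B\<in>\<Pi> j\<in>F. sets (config_space A (K j)). prob (\<Inter>j\<in>F. (\<lambda>\<omega>. restrict \<omega> (K j)) -` B j \<inter> space P) =
        (\<Prod>j\<in>F. prob ((\<lambda>\<omega>. restrict \<omega> (K j)) -` B j \<inter> space P))"
    proof
      fix B assume "B \<in> (\<Pi> j\<in>F. sets (config_space A (K j)))"
      then have "\<And>j. j \<in> F \<Longrightarrow> B j \<in> sets (config_space A (K j))" by auto
      from fubini[of B, OF this] show "prob (\<Inter>j\<in>F. (\<lambda>\<omega>. restrict \<omega> (K j)) -` B j \<inter> space P) =
        (\<Prod>j\<in>F. prob ((\<lambda>\<omega>. restrict \<omega> (K j)) -` B j \<inter> space P))"
        by (simp add: emeasure_eq_measure prod_ennreal prod_nonneg)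
    qed
    show "random_variable (config_space A (K j)) (\<lambda>\<omega>. restrict \<omega> (K j))" if "j \<in> F" for j
      by (rule restrict_measurable_config[OF sets])
  qed (simp_all add: sets.sigma_sets_eq Int_stable_def sets.space_closed sets.Int)
qed

section \<open>A Glivenko-Cantelli theorem for tile patterns\<close>

text \<open>
  The patterns seen in the tiles are independent by (M3), since the tiles are more than \<open>r\<close> apart, and
  identically distributed by (M1).
\<close>

lemma tile_averages_converge:
  fixes P :: "('d::finite lattice \<Rightarrow> real) measure"
  assumes P: "prob_space P" and sets: "sets P = sets (config_space A UNIV)"
    and M1: "M1 A P" and M2: "M2 A P \<mu>" and M3: "M3 A P \<mu> r" and m: "0 < m"
    and h [measurable]: "h \<in> borel_measurable (config_space A (lattice_box m))"
    and h01: "\<And>x. x \<in> space (config_space A (lattice_box m)) \<Longrightarrow> 0 \<le> h x \<and> h x \<le> 1"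
    and \<epsilon>: "0 < \<epsilon>"
  shows "AE \<omega> in P. \<forall>\<^sub>F k in sequentially.
    \<bar>(\<Sum>j\<in>lattice_box k. h (restrict (shift_config (tile_shift (m + r) j) \<omega>) (lattice_box m)))
       / real (card (lattice_box k :: 'd lattice set)) - (\<integral>x. h x \<partial>marginal A P (lattice_box m))\<bar> \<le> \<epsilon>"
proof -
  interpret prob_space P by (rule P)
  let ?C = "lattice_box m :: 'd lattice set"
  let ?z = "tile_shift (m + r) :: 'd lattice \<Rightarrow> _"
  note [measurable_cong] = sets
  note shift_config_measurable[of _ A, measurable]
  have [measurable]: "(\<lambda>\<omega>. restrict \<omega> ?C) \<in> measurable (config_space A UNIV) (config_space A ?C)"
    by (rule restrict_measurable_config) simp
  have shift [measurable]: "shift_config z \<in> measurable P (config_space A UNIV)" for z by measurable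
  have restr [measurable]: "(\<lambda>\<omega>. restrict \<omega> ?C) \<in> measurable P (config_space A ?C)" by measurable
  have inC: "restrict (shift_config z \<omega>) ?C \<in> space (config_space A ?C)" if "\<omega> \<in> space P" for z \<omega>
    using that measurable_space[OF measurable_comp[OF shift restrict_measurable_config[OF refl]]] by simp
  show ?thesis
  proof (rule bounded_independent_averages[OF _ _ _ _ _ \<epsilon>])
    show "finite (lattice_box k :: 'd lattice set)" for k by simp
    show "k \<le> card (lattice_box k :: 'd lattice set)" for k
      by (cases "k = 0") (auto simp: card_lattice_box intro!: self_le_power)
    show "0 \<le> h (restrict (shift_config (?z j) \<omega>) ?C) \<and> h (restrict (shift_config (?z j) \<omega>) ?C) \<le> 1"
      if "\<omega> \<in> space P" for j \<omega> by (rule h01) (rule inC[OF that])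
    show "expectation (\<lambda>\<omega>. h (restrict (shift_config (?z j) \<omega>) ?C)) = (\<integral>x. h x \<partial>marginal A P ?C)" for j
    proof -
      have "(\<integral>x. h x \<partial>marginal A P ?C) = (\<integral>\<omega>. h (restrict \<omega> ?C) \<partial>P)"
        unfolding marginal_def by (rule integral_distr) measurable
      also have "\<dots> = (\<integral>\<omega>. h (restrict \<omega> ?C) \<partial>distr P (config_space A UNIV) (shift_config (?z j)))"
        using M1 by (simp add: M1_def)
      also have "\<dots> = expectation (\<lambda>\<omega>. h (restrict (shift_config (?z j) \<omega>) ?C))"
        by (rule integral_distr) measurable
      finally show ?thesis by simp
    qed
    show "indep_vars (\<lambda>_. borel) (\<lambda>j \<omega>. h (restrict (shift_config (?z j) \<omega>) ?C)) (lattice_box k)"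
      if k: "0 < k" for k
    proof -
      let ?K = "\<lambda>j. translate ?C (?z j)"
      have K: "finite (?K j) \<and> ?K j \<noteq> {}" for j
        using zero_in_lattice_box[OF m, where 'a = 'd] by (auto simp: translate_def)
      have "indep_vars (\<lambda>j. config_space A (?K j)) (\<lambda>j \<omega>. restrict \<omega> (?K j)) (lattice_box k)"
      proof (rule indep_vars_separated_blocks[OF P sets M2 M3 _ _ K])
        show "lattice_box k \<noteq> {}" using zero_in_lattice_box[OF k] by blast
        show "int r < set_l1_dist (?K i) (?K j)" if "i \<noteq> j" for i j
          using K[of i] K[of j] tiles_separated[OF that] by (subst less_set_l1_dist_iff) auto
      qed simp
      then have "indep_vars (\<lambda>_. borel) (\<lambda>j \<omega>. h (\<lambda>x\<in>?C. restrict \<omega> (?K j) (x + ?z j))) (lattice_box k)"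
      proof (rule indep_vars_compose2)
        fix j
        have "(\<lambda>u. \<lambda>x\<in>?C. u (x + ?z j)) \<in> measurable (config_space A (?K j)) (config_space A ?C)"
          unfolding config_space_def
          by (rule measurable_restrict) (rule measurable_component_singleton, simp add: translate_def)
        then show "(\<lambda>u. h (\<lambda>x\<in>?C. u (x + ?z j))) \<in> borel_measurable (config_space A (?K j))"
          by (rule measurable_compose) (rule h)
      qed
      moreover have "(\<lambda>x\<in>?C. restrict \<omega> (?K j) (x + ?z j)) = restrict (shift_config (?z j) \<omega>) ?C" for \<omega> :: "'d lattice \<Rightarrow> real" and j
        by (auto simp: fun_eq_iff translate_def shift_config_def)
      ultimately show ?thesis by simp
    qed
  qed
qed

text \<open>
  Replacing the \<open>\<sigma>\<close>-finite reference measures by probability measures is possible only if they are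
  not zero; a zero measure is excluded because it would dominate a probability measure.
\<close>

lemma marginal_absolutely_continuous_probability_product:
  assumes P: "prob_space P" and sets: "sets P = sets (config_space A UNIV)" and M2: "M2 A P \<mu>"
  obtains m where "\<And>z. prob_space (m z)" "\<And>z. sets (m z) = sets (restrict_space borel A)"
    "\<And>\<Lambda>. finite \<Lambda> \<Longrightarrow> absolutely_continuous (PiM \<Lambda> m) (marginal A P \<Lambda>)"
proof -
  have sf: "sigma_finite_measure (\<mu> z)" for z using M2 by (simp add: M2_def)
  interpret product_sigma_finite \<mu> by (simp add: product_sigma_finite_def sf)
  have ac: "absolutely_continuous (PiM \<Lambda> \<mu>) (marginal A P \<Lambda>)" if "finite \<Lambda>" for \<Lambda>
    using M2 that by (simp add: M2_def)
  have ne: "emeasure (\<mu> z) (space (\<mu> z)) \<noteq> 0" for z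
  proof
    assume 0: "emeasure (\<mu> z) (space (\<mu> z)) = 0"
    have "emeasure (PiM {z} \<mu>) (Pi\<^sub>E {z} (\<lambda>z. space (\<mu> z))) = (\<Prod>z\<in>{z}. emeasure (\<mu> z) (space (\<mu> z)))"
      by (rule emeasure_PiM) auto
    then have "emeasure (PiM {z} \<mu>) (space (PiM {z} \<mu>)) = 0" using 0 by (simp add: space_PiM)
    then have "space (PiM {z} \<mu>) \<in> null_sets (PiM {z} \<mu>)" by (rule null_setsI) simp
    then have "space (PiM {z} \<mu>) \<in> null_sets (marginal A P {z})"
      using ac[of "{z}"] unfolding absolutely_continuous_def by blast
    moreover have "space (PiM {z} \<mu>) = space (marginal A P {z})"
      using sets_eq_imp_space_eq[OF sets_PiM_M2[OF M2]] by (simp add: marginal_def)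
    ultimately have "emeasure (marginal A P {z}) (space (marginal A P {z})) = 0"
      by (simp only: null_setsD1)
    with prob_space.emeasure_space_1[OF prob_space_marginal[OF P sets]] show False by simp
  qed
  obtain m where m: "\<And>z. prob_space (m z)" "\<And>z. sets (m z) = sets (\<mu> z)"
    "\<And>J. finite J \<Longrightarrow> absolutely_continuous (PiM J m) (PiM J \<mu>)"
    by (rule equivalent_probability_product[of \<mu>, OF sf ne]) (rule that)
  show thesis
  proof (rule that[of m])
    show "sets (m z) = sets (restrict_space borel A)" for z
      using M2 m(2) by (simp add: M2_def color_space_def)
    show "absolutely_continuous (PiM \<Lambda> m) (marginal A P \<Lambda>)" if "finite \<Lambda>" for \<Lambda>
      using m(3)[OF that] ac[OF that] unfolding absolutely_continuous_def by (rule order_trans)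
  qed (rule m(1))
qed

text \<open>
  The law of large numbers for the tiles holds uniformly over all monotone functions at once: each of
  them is caught in one of finitely many brackets, whose ends satisfy it and whose gaps are small for the
  marginal law because that law is absolutely continuous with respect to a product measure. The value
  \<open>c g\<close> is the mean of the lower end of a bracket chosen for \<open>g\<close>; it replaces the mean of \<open>g\<close>,
  which need not exist.
\<close>

lemma tile_Glivenko_Cantelli:
  fixes P :: "('d::finite lattice \<Rightarrow> real) measure" and s :: "'d lattice \<Rightarrow> real"
  assumes P: "prob_space P" and sets: "sets P = sets (config_space A UNIV)"
    and M1: "M1 A P" and M2: "M2 A P \<mu>" and M3: "M3 A P \<mu> r" and m: "0 < m"
    and s: "\<And>z. s z = 1 \<or> s z = -1" and \<epsilon>: "0 < \<epsilon>"
  shows "\<exists>c. AE \<omega> in P. \<forall>\<^sub>F k in sequentially. \<forall>g\<in>signed_monotone A s (lattice_box m).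
    \<bar>(\<Sum>j\<in>lattice_box k. g (restrict (shift_config (tile_shift (m + r) j) \<omega>) (lattice_box m)))
       / real (card (lattice_box k :: 'd lattice set)) - c g\<bar> \<le> \<epsilon>"
proof -
  interpret prob_space P by (rule P)
  let ?C = "lattice_box m :: 'd lattice set"
  let ?\<nu> = "marginal A P ?C"
  define X where "X j \<omega> = restrict (shift_config (tile_shift (m + r) j) \<omega>) ?C" for j \<omega>
  define avg where "avg h k \<omega> = (\<Sum>j\<in>lattice_box k. h (X j \<omega>)) / real (card (lattice_box k :: 'd lattice set))"
    for h :: "('d lattice \<Rightarrow> real) \<Rightarrow> real" and k \<omega>
  interpret \<nu>: prob_space ?\<nu> by (rule prob_space_marginal[OF P sets])
  obtain M where M: "\<And>z. prob_space (M z)" "\<And>z. sets (M z) = sets (restrict_space borel A)"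
    "\<And>\<Lambda>. finite \<Lambda> \<Longrightarrow> absolutely_continuous (PiM \<Lambda> M) (marginal A P \<Lambda>)"
    by (rule marginal_absolutely_continuous_probability_product[OF P sets M2]) (rule that)
  have sets_M: "sets (PiM ?C M) = sets (config_space A ?C)"
    unfolding config_space_def color_space_def by (intro sets_PiM_cong M(2) refl)
  have space_M: "space (PiM ?C M) = space (config_space A ?C)" by (rule sets_eq_imp_space_eq[OF sets_M])
  have sets_\<nu>: "sets ?\<nu> = sets (PiM ?C M)" by (simp add: marginal_def sets_M)
  have "finite_measure (PiM ?C M)" by (intro prob_space.finite_measure prob_space_PiM M)
  then have "\<exists>\<delta>>0. \<forall>h\<in>borel_measurable (PiM ?C M). (\<forall>x\<in>space (PiM ?C M). 0 \<le> h x \<and> h x \<le> 1) \<longrightarrow>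
      (\<integral>x. h x \<partial>PiM ?C M) \<le> \<delta> \<longrightarrow> (\<integral>x. h x \<partial>?\<nu>) \<le> \<epsilon> / 2"
    by (rule absolutely_continuous_small_integral[OF _ \<nu>.finite_measure_axioms M(3) sets_\<nu>])
       (use \<epsilon> in simp_all)
  then obtain \<delta> where \<delta>: "0 < \<delta>" "\<And>h. h \<in> borel_measurable (PiM ?C M) \<Longrightarrow>
      (\<forall>x\<in>space (PiM ?C M). 0 \<le> h x \<and> h x \<le> 1) \<Longrightarrow> (\<integral>x. h x \<partial>PiM ?C M) \<le> \<delta> \<Longrightarrow> (\<integral>x. h x \<partial>?\<nu>) \<le> \<epsilon> / 2"
    by blast
  obtain B where B: "finite B" "\<And>b. b \<in> B \<Longrightarrow> is_bracket (PiM ?C M) \<delta> b"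
      "\<And>g. g \<in> signed_monotone A s ?C \<Longrightarrow> \<exists>b\<in>B. in_bracket (space (PiM ?C M)) g b"
    using signed_monotone_finite_bracketing[of ?C M A s \<delta>, OF finite_lattice_box M(1,2) s \<delta>(1)] by metis
  have meas: "fst b \<in> borel_measurable (config_space A ?C)" "snd b \<in> borel_measurable (config_space A ?C)"
    and b01: "\<And>x. x \<in> space (config_space A ?C) \<Longrightarrow> 0 \<le> fst b x \<and> fst b x \<le> snd b x \<and> snd b x \<le> 1"
    if "b \<in> B" for b
    using B(2)[OF that] by (auto simp: is_bracket_def measurable_cong_sets[OF sets_M refl] space_M)
  have gap: "(\<integral>x. snd b x \<partial>?\<nu>) - (\<integral>x. fst b x \<partial>?\<nu>) \<le> \<epsilon> / 2" if b: "b \<in> B" for b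
  proof -
    have abs1: "\<bar>fst b x\<bar> \<le> 1 \<and> \<bar>snd b x\<bar> \<le> 1 \<and> 0 \<le> snd b x - fst b x \<and> snd b x - fst b x \<le> 1"
      if "x \<in> space (config_space A ?C)" for x
      using b01[OF b that] by auto
    have "integrable ?\<nu> (fst b)" "integrable ?\<nu> (snd b)"
      by (rule \<nu>.integrable_const_bound[where B = 1, OF AE_I2];
          use abs1 meas[OF b] in \<open>simp add: marginal_def\<close>)+
    then have "(\<integral>x. snd b x \<partial>?\<nu>) - (\<integral>x. fst b x \<partial>?\<nu>) = (\<integral>x. snd b x - fst b x \<partial>?\<nu>)" by simp
    also have "\<dots> \<le> \<epsilon> / 2"
    proof (rule \<delta>(2))
      show "(\<lambda>x. snd b x - fst b x) \<in> borel_measurable (PiM ?C M)"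
        using B(2)[OF b] by (auto simp: is_bracket_def)
      show "\<forall>x\<in>space (PiM ?C M). 0 \<le> snd b x - fst b x \<and> snd b x - fst b x \<le> 1"
        using abs1 by (simp add: space_M)
      show "(\<integral>x. snd b x - fst b x \<partial>PiM ?C M) \<le> \<delta>" using B(2)[OF b] by (simp add: is_bracket_def)
    qed
    finally show ?thesis .
  qed
  \<comment> \<open>The law of large numbers is applied to the finitely many bracket functions only.\<close>
  have conv: "AE \<omega> in P. \<forall>\<^sub>F k in sequentially. \<bar>avg h k \<omega> - (\<integral>x. h x \<partial>?\<nu>)\<bar> \<le> \<epsilon> / 2"
    if "h \<in> borel_measurable (config_space A ?C)" "\<And>x. x \<in> space (config_space A ?C) \<Longrightarrow> 0 \<le> h x \<and> h x \<le> 1" for h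
    unfolding avg_def X_def
    by (rule tile_averages_converge[OF P sets M1 M2 M3 m that]) (use \<epsilon> in auto)
  have conv_b: "AE \<omega> in P. \<forall>\<^sub>F k in sequentially. \<bar>avg (fst b) k \<omega> - (\<integral>x. fst b x \<partial>?\<nu>)\<bar> \<le> \<epsilon> / 2 \<and>
      \<bar>avg (snd b) k \<omega> - (\<integral>x. snd b x \<partial>?\<nu>)\<bar> \<le> \<epsilon> / 2" if b: "b \<in> B" for b
  proof -
    have "0 \<le> fst b x \<and> fst b x \<le> 1" "0 \<le> snd b x \<and> snd b x \<le> 1" if "x \<in> space (config_space A ?C)" for x
      using b01[OF b that] by auto
    with conv[OF meas(1)[OF b]] conv[OF meas(2)[OF b]] show ?thesis
      by (simp add: eventually_conj_iff AE_conj_iff)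
  qed
  have "AE \<omega> in P. \<forall>b\<in>B. \<forall>\<^sub>F k in sequentially. \<bar>avg (fst b) k \<omega> - (\<integral>x. fst b x \<partial>?\<nu>)\<bar> \<le> \<epsilon> / 2 \<and>
      \<bar>avg (snd b) k \<omega> - (\<integral>x. snd b x \<partial>?\<nu>)\<bar> \<le> \<epsilon> / 2"
    by (rule AE_finite_allI[OF B(1) conv_b])
  then have AE: "AE \<omega> in P. \<forall>\<^sub>F k in sequentially. \<forall>b\<in>B. \<bar>avg (fst b) k \<omega> - (\<integral>x. fst b x \<partial>?\<nu>)\<bar> \<le> \<epsilon> / 2 \<and>
      \<bar>avg (snd b) k \<omega> - (\<integral>x. snd b x \<partial>?\<nu>)\<bar> \<le> \<epsilon> / 2"
    by (simp add: eventually_ball_finite_distrib[OF B(1)])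
  define br where "br g = (SOME b. b \<in> B \<and> in_bracket (space (config_space A ?C)) g b)" for g
  have br: "br g \<in> B" "in_bracket (space (config_space A ?C)) g (br g)" if "g \<in> signed_monotone A s ?C" for g
  proof -
    have "\<exists>b. b \<in> B \<and> in_bracket (space (config_space A ?C)) g b" using B(3)[OF that] space_M by auto
    from someI_ex[OF this] show "br g \<in> B" "in_bracket (space (config_space A ?C)) g (br g)"
      unfolding br_def by blast+
  qed
  have X: "X j \<omega> \<in> space (config_space A ?C)" if "\<omega> \<in> space P" for j \<omega>
    unfolding X_def
    using measurable_space[OF restrict_measurable_config[OF refl], OF measurable_space[OF shift_config_measurable]]
      that sets_eq_imp_space_eq[OF sets] by simp
  show ?thesis
  proof (intro exI[of _ "\<lambda>g. \<integral>x. fst (br g) x \<partial>?\<nu>"], rule AE_mp[OF AE], intro AE_I2 impI)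
    fix \<omega> assume \<omega>: "\<omega> \<in> space P"
    assume "\<forall>\<^sub>F k in sequentially. \<forall>b\<in>B. \<bar>avg (fst b) k \<omega> - (\<integral>x. fst b x \<partial>?\<nu>)\<bar> \<le> \<epsilon> / 2 \<and>
      \<bar>avg (snd b) k \<omega> - (\<integral>x. snd b x \<partial>?\<nu>)\<bar> \<le> \<epsilon> / 2"
    then have "\<forall>\<^sub>F k in sequentially. \<forall>g\<in>signed_monotone A s ?C. \<bar>avg g k \<omega> - (\<integral>x. fst (br g) x \<partial>?\<nu>)\<bar> \<le> \<epsilon>"
    proof (rule eventually_mono, intro ballI)
      fix k g assume k: "\<forall>b\<in>B. \<bar>avg (fst b) k \<omega> - (\<integral>x. fst b x \<partial>?\<nu>)\<bar> \<le> \<epsilon> / 2 \<and>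
        \<bar>avg (snd b) k \<omega> - (\<integral>x. snd b x \<partial>?\<nu>)\<bar> \<le> \<epsilon> / 2" and g: "g \<in> signed_monotone A s ?C"
      have "avg (fst (br g)) k \<omega> \<le> avg g k \<omega>" "avg g k \<omega> \<le> avg (snd (br g)) k \<omega>"
        unfolding avg_def using in_bracketD[OF br(2)[OF g] X[OF \<omega>]]
        by (intro divide_right_mono sum_mono; simp)+
      with bspec[OF k br(1)[OF g]] gap[OF br(1)[OF g]]
      show "\<bar>avg g k \<omega> - (\<integral>x. fst (br g) x \<partial>?\<nu>)\<bar> \<le> \<epsilon>" by linarith
    qed
    then show "\<forall>\<^sub>F k in sequentially. \<forall>g\<in>signed_monotone A s ?C.
      \<bar>(\<Sum>j\<in>lattice_box k. g (restrict (shift_config (tile_shift (m + r) j) \<omega>) ?C))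
       / real (card (lattice_box k :: 'd lattice set)) - (\<integral>x. fst (br g) x \<partial>?\<nu>)\<bar> \<le> \<epsilon>"
      by (simp only: avg_def X_def)
  qed
qed

section \<open>Uniform limits that do not depend on the configuration\<close>

text \<open>
  The bound is needed because the supremum of an unbounded set of reals carries no information.
\<close>

lemma abs_le_sup_norm:
  assumes "\<And>E. \<bar>F E\<bar> \<le> B"
  shows "\<bar>F E\<bar> \<le> sup_norm F"
  unfolding sup_norm_def by (rule cSUP_upper) (use assms in \<open>auto intro!: bdd_aboveI[of _ B]\<close>)

text \<open>
  The approximants \<open>c\<close> do not depend on \<open>\<omega>\<close>. Two of them are close because both are close to
  \<open>F n \<omega>\<close> for one good \<open>\<omega>\<close> and one large \<open>n\<close>; so they converge uniformly, to a limit that serves all good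
  \<open>\<omega>\<close>. Boundedness and right-continuity pass to the limit from the functions \<open>F n \<omega>\<close> of that \<open>\<omega>\<close>.
\<close>

lemma deterministic_uniform_limit:
  fixes F :: "nat \<Rightarrow> 'w \<Rightarrow> real \<Rightarrow> real"
  assumes P: "prob_space P"
    and approx: "\<And>\<epsilon>. 0 < \<epsilon> \<Longrightarrow> \<exists>c. AE \<omega> in P. \<forall>\<^sub>F n in sequentially. \<forall>E. \<bar>F n \<omega> E - c E\<bar> \<le> \<epsilon>"
    and F: "\<And>n \<omega>. \<omega> \<in> space P \<Longrightarrow> F n \<omega> \<in> rc_bounded"
  shows "\<exists>\<Omega>'\<in>sets P. measure P \<Omega>' = 1 \<and>
    (\<exists>g\<in>rc_bounded. \<forall>\<omega>\<in>\<Omega>'. (\<lambda>n. sup_norm (\<lambda>E. F n \<omega> E - g E)) \<longlonglongrightarrow> 0)"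
proof -
  interpret prob_space P by (rule P)
  let ?e = "\<lambda>i. 1 / real (Suc i)"
  have "\<forall>i. \<exists>c. AE \<omega> in P. \<forall>\<^sub>F n in sequentially. \<forall>E. \<bar>F n \<omega> E - c E\<bar> \<le> ?e i"
    by (intro allI approx) simp
  from choice[OF this] obtain c where "\<forall>i. AE \<omega> in P. \<forall>\<^sub>F n in sequentially. \<forall>E. \<bar>F n \<omega> E - c i E\<bar> \<le> ?e i"
    by (rule exE)
  note c = this[THEN spec]
  have "AE \<omega> in P. \<forall>i. \<forall>\<^sub>F n in sequentially. \<forall>E. \<bar>F n \<omega> E - c i E\<bar> \<le> ?e i"
    unfolding AE_all_countable by (rule allI) (rule c)
  then obtain N where N: "{\<omega> \<in> space P. \<not> (\<forall>i. \<forall>\<^sub>F n in sequentially. \<forall>E. \<bar>F n \<omega> E - c i E\<bar> \<le> ?e i)} \<subseteq> N"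
    "emeasure P N = 0" "N \<in> sets P" by (rule AE_E)
  define \<Omega>' where "\<Omega>' = space P - N"
  have \<Omega>'_sets: "\<Omega>' \<in> sets P" using N(3) by (simp add: \<Omega>'_def)
  have one: "measure P \<Omega>' = 1"
  proof -
    have "prob N = 0" using N(2) by (simp add: emeasure_eq_measure)
    then show ?thesis unfolding \<Omega>'_def by (simp add: prob_compl[OF N(3)])
  qed
  have \<Omega>': "\<omega> \<in> space P" "\<forall>\<^sub>F n in sequentially. \<forall>E. \<bar>F n \<omega> E - c i E\<bar> \<le> ?e i" if "\<omega> \<in> \<Omega>'" for \<omega> i
  proof -
    show "\<omega> \<in> space P" using that by (simp add: \<Omega>'_def)
    have "\<omega> \<notin> {\<omega> \<in> space P. \<not> (\<forall>i. \<forall>\<^sub>F n in sequentially. \<forall>E. \<bar>F n \<omega> E - c i E\<bar> \<le> ?e i)}"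
      using that N(1) unfolding \<Omega>'_def by blast
    then show "\<forall>\<^sub>F n in sequentially. \<forall>E. \<bar>F n \<omega> E - c i E\<bar> \<le> ?e i"
      using \<open>\<omega> \<in> space P\<close> by (simp only: mem_Collect_eq simp_thms)
  qed
  have "\<Omega>' \<noteq> {}"
  proof
    assume "\<Omega>' = {}"
    with one show False by simp
  qed
  then obtain \<omega>0 where \<omega>0: "\<omega>0 \<in> \<Omega>'" by blast
  \<comment> \<open>The approximants are compared through a single good configuration.\<close>
  have cc: "\<bar>c i E - c j E\<bar> \<le> ?e i + ?e j" for i j E
  proof -
    have "\<forall>\<^sub>F n in sequentially. \<bar>F n \<omega>0 E - c i E\<bar> \<le> ?e i \<and> \<bar>F n \<omega>0 E - c j E\<bar> \<le> ?e j"
      using eventually_conj[OF \<Omega>'(2)[OF \<omega>0, of i] \<Omega>'(2)[OF \<omega>0, of j]] by (rule eventually_mono) simp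
    then obtain n where "\<bar>F n \<omega>0 E - c i E\<bar> \<le> ?e i" "\<bar>F n \<omega>0 E - c j E\<bar> \<le> ?e j"
      using eventually_happens'[OF sequentially_bot] by blast
    then show ?thesis by linarith
  qed
  have e0: "?e \<longlonglongrightarrow> 0" by (rule LIMSEQ_Suc) (rule lim_1_over_n)
  have "Cauchy (\<lambda>i. c i E)" for E
  proof (rule metric_CauchyI)
    fix \<epsilon> :: real assume "0 < \<epsilon>"
    then have "\<forall>\<^sub>F i in sequentially. ?e i < \<epsilon> / 2" using e0 by (intro order_tendstoD(2)) auto
    then obtain M where M: "\<And>i. M \<le> i \<Longrightarrow> ?e i < \<epsilon> / 2" by (auto simp only: eventually_sequentially)
    have "dist (c i E) (c j E) < \<epsilon>" if "M \<le> i" "M \<le> j" for i j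
      using cc[of i E j] M[OF that(1)] M[OF that(2)] unfolding dist_real_def by linarith
    then show "\<exists>M. \<forall>m\<ge>M. \<forall>n\<ge>M. dist (c m E) (c n E) < \<epsilon>" by blast
  qed
  then have conv: "(\<lambda>i. c i E) \<longlonglongrightarrow> lim (\<lambda>i. c i E)" for E
    by (simp add: Cauchy_convergent_iff convergent_LIMSEQ_iff)
  define g where "g E = lim (\<lambda>i. c i E)" for E
  have cg: "\<bar>c i E - g E\<bar> \<le> ?e i" for i E
  proof (rule LIMSEQ_le)
    show "(\<lambda>j. \<bar>c i E - c j E\<bar>) \<longlonglongrightarrow> \<bar>c i E - g E\<bar>" unfolding g_def by (intro tendsto_intros conv)
    show "(\<lambda>j. ?e i + ?e j) \<longlonglongrightarrow> ?e i" using tendsto_add[OF tendsto_const e0, of "?e i"] by simp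
    show "\<exists>N. \<forall>j\<ge>N. \<bar>c i E - c j E\<bar> \<le> ?e i + ?e j" using cc by blast
  qed
  have close: "\<forall>\<^sub>F n in sequentially. \<forall>E. \<bar>F n \<omega> E - g E\<bar> \<le> 2 * ?e i" if "\<omega> \<in> \<Omega>'" for \<omega> i
    using \<Omega>'(2)[OF that, of i]
  proof eventually_elim
    case (elim n)
    show ?case
    proof
      fix E show "\<bar>F n \<omega> E - g E\<bar> \<le> 2 * ?e i" using spec[OF elim, of E] cg[of i E] by linarith
    qed
  qed
  have small: "\<forall>\<^sub>F n in sequentially. \<forall>E. \<bar>F n \<omega> E - g E\<bar> \<le> \<epsilon>" if \<omega>: "\<omega> \<in> \<Omega>'" and \<epsilon>: "0 < \<epsilon>" for \<omega> \<epsilon>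
  proof -
    have "\<forall>\<^sub>F i in sequentially. ?e i < \<epsilon> / 2" using e0 \<epsilon> by (intro order_tendstoD(2)) auto
    then obtain i where i: "?e i < \<epsilon> / 2" using eventually_happens'[OF sequentially_bot] by blast
    show ?thesis using close[OF \<omega>, of i]
    proof eventually_elim
      case (elim n)
      show ?case
      proof
        fix E show "\<bar>F n \<omega> E - g E\<bar> \<le> \<epsilon>" using spec[OF elim, of E] i by linarith
      qed
    qed
  qed
  have lim: "(\<lambda>n. sup_norm (\<lambda>E. F n \<omega> E - g E)) \<longlonglongrightarrow> 0" if \<omega>: "\<omega> \<in> \<Omega>'" for \<omega>
  proof (rule tendstoI)
    fix \<epsilon> :: real assume \<epsilon>: "0 < \<epsilon>"
    then have "0 < \<epsilon> / 2" by simp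
    from small[OF \<omega> this] show "\<forall>\<^sub>F n in sequentially. dist (sup_norm (\<lambda>E. F n \<omega> E - g E)) 0 < \<epsilon>"
    proof eventually_elim
      case (elim n)
      have "sup_norm (\<lambda>E. F n \<omega> E - g E) \<le> \<epsilon> / 2"
        unfolding sup_norm_def by (rule cSUP_least) (use elim in auto)
      moreover have "0 \<le> \<bar>F n \<omega> 0 - g 0\<bar>" by simp
      moreover have "\<bar>F n \<omega> 0 - g 0\<bar> \<le> sup_norm (\<lambda>E. F n \<omega> E - g E)"
        by (rule abs_le_sup_norm[where B = "\<epsilon> / 2"]) (rule spec[OF elim])
      ultimately show ?case using \<epsilon> unfolding dist_real_def by linarith
    qed
  qed
  have "g \<in> rc_bounded" unfolding rc_bounded_def mem_Collect_eq
  proof (intro conjI allI)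
    have Frc: "F n \<omega>0 \<in> rc_bounded" for n by (rule F[OF \<Omega>'(1)[OF \<omega>0]])
    show "continuous (at_right E) g" for E
      unfolding continuous_within
    proof (rule swap_uniform_limit'[where S = UNIV and f = "\<lambda>n. F n \<omega>0" and F = sequentially and g = "\<lambda>n. F n \<omega>0 E"])
      show "\<forall>\<^sub>F n in sequentially. (F n \<omega>0 \<longlongrightarrow> F n \<omega>0 E) (at_right E)"
        using Frc by (simp add: rc_bounded_def continuous_within)
      show ul: "uniform_limit UNIV (\<lambda>n. F n \<omega>0) g sequentially"
      proof (rule uniform_limitI)
        fix \<epsilon> :: real assume \<epsilon>: "0 < \<epsilon>"
        then have "0 < \<epsilon> / 2" by simp
        from small[OF \<omega>0 this] show "\<forall>\<^sub>F n in sequentially. \<forall>x\<in>UNIV. dist (F n \<omega>0 x) (g x) < \<epsilon>"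
        proof eventually_elim
          case (elim n)
          show ?case
          proof
            fix x show "dist (F n \<omega>0 x) (g x) < \<epsilon>" using spec[OF elim, of x] \<epsilon> unfolding dist_real_def by linarith
          qed
        qed
      qed
      show "(\<lambda>n. F n \<omega>0 E) \<longlonglongrightarrow> g E" by (rule tendsto_uniform_limitI[OF ul]) simp
    qed simp_all
    from small[OF \<omega>0 zero_less_one] obtain n where n: "\<forall>E. \<bar>F n \<omega>0 E - g E\<bar> \<le> 1"
      using eventually_happens'[OF sequentially_bot] by blast
    have "bounded (range (F n \<omega>0))" using Frc[of n] by (simp add: rc_bounded_def)
    then obtain B where B: "\<forall>y\<in>range (F n \<omega>0). norm y \<le> B" unfolding bounded_iff by blast
    show "bounded (range g)" unfolding bounded_iff
    proof (intro exI[of _ "B + 1"] ballI)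
      fix y assume "y \<in> range g"
      then obtain E where y: "y = g E" by blast
      have "\<bar>F n \<omega>0 E\<bar> \<le> B" using B by simp
      then show "norm y \<le> B + 1" using spec[OF n, of E] unfolding y real_norm_def by linarith
    qed
  qed
  with \<Omega>'_sets one lim show ?thesis by blast
qed

section \<open>Almost additive functions on tiled boxes\<close>

lemma shift_config_in_configs: "\<omega> \<in> configs A \<Longrightarrow> shift_config z \<omega> \<in> configs A"
  using measurable_space[OF shift_config_measurable] by blast

lemma configs_iff: "\<omega> \<in> configs A \<longleftrightarrow> (\<forall>z. \<omega> z \<in> A)"
  by (auto simp: config_space_def color_space_def space_PiM space_restrict_space PiE_iff)

lemma finite_translate [simp]: "finite \<Lambda> \<Longrightarrow> finite (translate \<Lambda> z)"
  by (simp add: translate_def)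

lemma card_translate [simp]: "card (translate \<Lambda> z) = card \<Lambda>"
  unfolding translate_def by (rule card_image) simp

text \<open>
  The coordinates in \<open>\<Lambda>\<close> are changed one after the other; after the last one the configuration agrees
  with \<open>\<omega>'\<close> on \<open>\<Lambda>\<close>, and locality ignores the rest.
\<close>

lemma configs_monotone:
  assumes mono: "coordinatewise_monotone A f s"
    and local: "\<forall>\<omega>\<in>configs A. \<forall>\<omega>'\<in>configs A. restrict \<omega> \<Lambda> = restrict \<omega>' \<Lambda> \<longrightarrow> f \<Lambda> \<omega> = f \<Lambda> \<omega>'"
    and \<Lambda>: "finite \<Lambda>" and \<omega>: "\<omega> \<in> configs A" "\<omega>' \<in> configs A"
    and le: "\<forall>z\<in>\<Lambda>. real_of_int (s z) * \<omega> z \<le> real_of_int (s z) * \<omega>' z"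
  shows "f \<Lambda> \<omega> E \<le> f \<Lambda> \<omega>' E"
proof -
  define mix where "mix S = (\<lambda>z. if z \<in> S then \<omega>' z else \<omega> z)" for S
  have mix: "mix S \<in> configs A" for S using \<omega> by (simp add: configs_iff mix_def)
  have "f \<Lambda> \<omega> E \<le> f \<Lambda> (mix S) E" if "finite S" "S \<subseteq> \<Lambda>" for S
    using that
  proof (induction S rule: finite_induct)
    case empty
    have "mix {} = \<omega>" by (simp add: mix_def)
    then show ?case by simp
  next
    case (insert z S)
    have z: "z \<in> \<Lambda>" using insert.prems by auto
    have eq: "restrict (mix S) (\<Lambda> - {z}) = restrict (mix (insert z S)) (\<Lambda> - {z})"
      by (auto simp: mix_def fun_eq_iff)
    have vals: "mix S z = \<omega> z" "mix (insert z S) z = \<omega>' z" using insert.hyps by (auto simp: mix_def)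
    have sz: "s z = 1 \<or> s z = -1" using mono by (auto simp: coordinatewise_monotone_def)
    have step: "\<And>\<alpha> \<beta>. \<alpha> \<in> configs A \<Longrightarrow> \<beta> \<in> configs A \<Longrightarrow> restrict \<alpha> (\<Lambda> - {z}) = restrict \<beta> (\<Lambda> - {z}) \<Longrightarrow>
        \<alpha> z \<le> \<beta> z \<Longrightarrow> (s z = 1 \<longrightarrow> f \<Lambda> \<alpha> E \<le> f \<Lambda> \<beta> E) \<and> (s z = -1 \<longrightarrow> f \<Lambda> \<beta> E \<le> f \<Lambda> \<alpha> E)"
      using mono z \<Lambda> unfolding coordinatewise_monotone_def by blast
    have "f \<Lambda> (mix S) E \<le> f \<Lambda> (mix (insert z S)) E"
      using sz
    proof
      assume "s z = 1"
      then show ?thesis using step[OF mix mix eq] bspec[OF le z] vals by simp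
    next
      assume "s z = -1"
      then show ?thesis using step[OF mix mix eq[symmetric]] bspec[OF le z] vals by simp
    qed
    then show ?case using insert.IH insert.prems by simp
  qed
  from this[OF \<Lambda> order_refl] have "f \<Lambda> \<omega> E \<le> f \<Lambda> (mix \<Lambda>) E" .
  also have "f \<Lambda> (mix \<Lambda>) = f \<Lambda> \<omega>'"
    by (rule local[rule_format, OF mix \<omega>(2)]) (auto simp: mix_def fun_eq_iff)
  finally show ?thesis .
qed

text \<open>
  The part of admissibility that enters the deterministic estimates, with its constants named: \<open>D\<close>
  bounds the defect \<open>b\<close> per site and \<open>K\<close> bounds \<open>f\<close> on a single site.
\<close>

locale almost_additive_function =
  fixes A :: "real set" and f :: "'d::finite lattice set \<Rightarrow> ('d lattice \<Rightarrow> real) \<Rightarrow> real \<Rightarrow> real"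
    and b :: "'d lattice set \<Rightarrow> real" and D K :: real
  assumes rc: "finite \<Lambda> \<Longrightarrow> \<omega> \<in> configs A \<Longrightarrow> f \<Lambda> \<omega> \<in> rc_bounded"
    and covariant: "finite \<Lambda> \<Longrightarrow> \<omega> \<in> configs A \<Longrightarrow> f (translate \<Lambda> z) \<omega> = f \<Lambda> (shift_config z \<omega>)"
    and additive: "almost_additive A f b"
    and b_le: "finite \<Lambda> \<Longrightarrow> b \<Lambda> \<le> D * real (card \<Lambda>)"
    and origin_le: "\<omega> \<in> configs A \<Longrightarrow> sup_norm (f {0} \<omega>) \<le> K"
    and D_pos: "0 < D" and K_nonneg: "0 \<le> K"
begin

lemma b_nonneg: "finite \<Lambda> \<Longrightarrow> 0 \<le> b \<Lambda>"
  using additive[unfolded almost_additive_def, THEN conjunct1] by simp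

lemma b_translate: "finite \<Lambda> \<Longrightarrow> b (translate \<Lambda> z) = b \<Lambda>"
  using additive[unfolded almost_additive_def, THEN conjunct2, THEN conjunct2, THEN conjunct1] by simp

lemma f_bounded:
  assumes "finite \<Lambda>" "\<omega> \<in> configs A"
  shows "\<exists>B. \<forall>E. \<bar>f \<Lambda> \<omega> E\<bar> \<le> B"
proof -
  have "bounded (range (f \<Lambda> \<omega>))" using rc[OF assms] by (simp add: rc_bounded_def)
  then obtain B where "\<forall>y\<in>range (f \<Lambda> \<omega>). norm y \<le> B" unfolding bounded_iff by blast
  then show ?thesis by (intro exI[of _ B]) simp
qed

text \<open>
  Indexing by the parts themselves lets a family of tiles be combined with a family of points.
\<close>

lemma partition_estimate:
  assumes \<omega>: "\<omega> \<in> configs A" and Q: "finite \<Q>" "\<Q> \<noteq> {}" "\<And>Q. Q \<in> \<Q> \<Longrightarrow> finite Q" "disjoint \<Q>"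
  shows "\<bar>f (\<Union>\<Q>) \<omega> E - (\<Sum>Q\<in>\<Q>. f Q \<omega> E)\<bar> \<le> (\<Sum>Q\<in>\<Q>. b Q)"
proof -
  obtain h where h: "bij_betw h {1..card \<Q>} \<Q>" using ex_bij_betw_nat_finite_1[OF Q(1)] by blast
  have hQ: "h i \<in> \<Q>" if "i \<in> {1..card \<Q>}" for i using bij_betwE[OF h] that by blast
  have n: "1 \<le> card \<Q>" using Q(1,2) by (simp add: Suc_le_eq card_gt_0_iff)
  have disj: "disjoint_family_on h {1..card \<Q>}"
    unfolding disjoint_family_on_def
  proof (intro ballI impI)
    fix i j assume ij: "i \<in> {1..card \<Q>}" "j \<in> {1..card \<Q>}" "i \<noteq> j"
    then have "h i \<noteq> h j" using inj_on_eq_iff[OF bij_betw_imp_inj_on[OF h]] by blast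
    then show "h i \<inter> h j = {}" using disjointD[OF Q(4) hQ[OF ij(1)] hQ[OF ij(2)]] by blast
  qed
  have U: "(\<Union>i\<in>{1..card \<Q>}. h i) = \<Union>\<Q>" using bij_betw_imp_surj_on[OF h] by simp
  let ?F = "\<lambda>E. f (\<Union>\<Q>) \<omega> E - (\<Sum>Q\<in>\<Q>. f Q \<omega> E)"
  have "\<forall>\<omega>\<in>configs A. \<forall>(n::nat) \<Lambda>. n \<ge> 1 \<longrightarrow> (\<forall>i\<in>{1..n}. finite (\<Lambda> i)) \<longrightarrow> disjoint_family_on \<Lambda> {1..n} \<longrightarrow>
        sup_norm (\<lambda>E. f (\<Union>i\<in>{1..n}. \<Lambda> i) \<omega> E - (\<Sum>i\<in>{1..n}. f (\<Lambda> i) \<omega> E)) \<le> (\<Sum>i\<in>{1..n}. b (\<Lambda> i))"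
    by (rule additive[unfolded almost_additive_def, THEN conjunct2, THEN conjunct1])
  from this[THEN bspec, OF \<omega>, THEN spec, of "card \<Q>", THEN spec, of h, THEN mp, OF n, THEN mp, THEN mp, OF _ disj]
  have "sup_norm (\<lambda>E. f (\<Union>\<Q>) \<omega> E - (\<Sum>i\<in>{1..card \<Q>}. f (h i) \<omega> E)) \<le> (\<Sum>i\<in>{1..card \<Q>}. b (h i))"
    unfolding U using hQ Q(3) by blast
  then have le: "sup_norm ?F \<le> (\<Sum>Q\<in>\<Q>. b Q)"
    by (simp only: sum.reindex_bij_betw[OF h, of b] sum.reindex_bij_betw[OF h, of "\<lambda>Q. f Q \<omega> E" for E])
  have "finite (\<Union>\<Q>)" using Q by auto
  from f_bounded[OF this \<omega>] obtain B0 where B0: "\<And>E. \<bar>f (\<Union>\<Q>) \<omega> E\<bar> \<le> B0" by blast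
  have "\<forall>Q\<in>\<Q>. \<exists>B. \<forall>E. \<bar>f Q \<omega> E\<bar> \<le> B" using f_bounded[OF Q(3) \<omega>] by blast
  from bchoice[OF this] obtain B where B: "\<And>Q E. Q \<in> \<Q> \<Longrightarrow> \<bar>f Q \<omega> E\<bar> \<le> B Q" by blast
  have "\<bar>?F E\<bar> \<le> B0 + (\<Sum>Q\<in>\<Q>. B Q)" for E
  proof -
    have "\<bar>\<Sum>Q\<in>\<Q>. f Q \<omega> E\<bar> \<le> (\<Sum>Q\<in>\<Q>. B Q)"
      by (rule order_trans[OF sum_abs sum_mono]) (rule B)
    then show ?thesis using B0[of E] by linarith
  qed
  from abs_le_sup_norm[of ?F, OF this] le show ?thesis by (rule order_trans)
qed

lemma point_bound:
  assumes "\<omega> \<in> configs A"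
  shows "\<bar>f {x} \<omega> E\<bar> \<le> K"
proof -
  have "translate {0} x = {x}" by (simp add: translate_def)
  then have x: "f {x} \<omega> = f {0} (shift_config x \<omega>)" using covariant[of "{0}" \<omega> x] assms by simp
  obtain B where "\<And>E. \<bar>f {0} (shift_config x \<omega>) E\<bar> \<le> B"
    using f_bounded[OF finite.insertI[OF finite.emptyI, of 0] shift_config_in_configs[OF assms, of x]] by blast
  from abs_le_sup_norm[of "f {0} (shift_config x \<omega>)", OF this, of E]
    origin_le[OF shift_config_in_configs[OF assms, of x]]
  show ?thesis unfolding x by (rule order_trans)
qed

text \<open>
  Splitting \<open>\<Lambda>\<close> into points costs at most \<open>D\<close> and contributes at most \<open>K\<close> for each of them.
\<close>

lemma volume_bound:
  assumes \<omega>: "\<omega> \<in> configs A" and \<Lambda>: "finite \<Lambda>" "\<Lambda> \<noteq> {}"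
  shows "\<bar>f \<Lambda> \<omega> E\<bar> \<le> (D + K) * real (card \<Lambda>)"
proof -
  let ?Q = "(\<lambda>x. {x}) ` \<Lambda>"
  have "\<bar>f (\<Union>?Q) \<omega> E - (\<Sum>Q\<in>?Q. f Q \<omega> E)\<bar> \<le> (\<Sum>Q\<in>?Q. b Q)"
  proof (rule partition_estimate[OF \<omega>])
    show "disjoint ?Q" by (rule disjointI) blast
  qed (use \<Lambda> in blast)+
  then have "\<bar>f \<Lambda> \<omega> E - (\<Sum>x\<in>\<Lambda>. f {x} \<omega> E)\<bar> \<le> (\<Sum>x\<in>\<Lambda>. b {x})"
    by (simp add: sum.reindex)
  moreover have "(\<Sum>x\<in>\<Lambda>. b {x}) \<le> (\<Sum>x\<in>\<Lambda>. D)"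
    by (rule sum_mono) (use b_le[of "{x}" for x] in simp)
  moreover have "\<bar>\<Sum>x\<in>\<Lambda>. f {x} \<omega> E\<bar> \<le> (\<Sum>x\<in>\<Lambda>. K)"
    by (rule order_trans[OF sum_abs sum_mono]) (rule point_bound[OF \<omega>])
  ultimately show ?thesis by (simp add: algebra_simps)
qed

lemma tiling_sum_estimate:
  fixes E :: real
  assumes \<omega>: "\<omega> \<in> configs A" and m: "0 < m" and k: "0 < k" and kn: "k * (m + r) \<le> n"
  defines "C \<equiv> lattice_box m :: 'd lattice set"
  defines "S \<equiv> \<Sum>j\<in>lattice_box k. f C (shift_config (tile_shift (m + r) j) \<omega>) E"
  shows "\<bar>f (lattice_box n) \<omega> E - S\<bar>
      \<le> real k ^ CARD('d) * b C + (D + K) * (real n ^ CARD('d) - real k ^ CARD('d) * real m ^ CARD('d))"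
proof -
  let ?T = "\<lambda>j. translate C (tile_shift (m + r) j)"
  let ?U = "\<Union>j\<in>lattice_box k. ?T j"
  let ?R = "lattice_box n - ?U"
  let ?Q1 = "?T ` lattice_box k" and ?Q2 = "(\<lambda>x. {x}) ` ?R"
  have finC: "finite C" and cardC: "card C = m ^ CARD('d)" by (simp_all add: C_def card_lattice_box)
  have disj_T: "?T i \<inter> ?T j = {}" if "i \<noteq> j" for i j
  proof (rule ccontr)
    assume "?T i \<inter> ?T j \<noteq> {}"
    then obtain x where "x \<in> ?T i" "x \<in> ?T j" by auto
    from tiles_separated[OF that this[unfolded C_def]] show False by simp
  qed
  have T_ne: "?T j \<noteq> {}" for j using zero_in_lattice_box[OF m] by (auto simp: translate_def C_def)
  have inj: "inj_on ?T (lattice_box k)"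
  proof (rule inj_onI, rule ccontr)
    fix i j assume "?T i = ?T j" "i \<noteq> j"
    with disj_T[OF this(2)] T_ne[of j] show False by simp
  qed
  have sub: "?U \<subseteq> lattice_box n"
  proof
    fix x assume "x \<in> ?U"
    then obtain j u where j: "j \<in> lattice_box k" and u: "u \<in> C" and x: "x = u + tile_shift (m + r) j"
      by (auto simp: translate_def)
    show "x \<in> lattice_box n" unfolding lattice_box_def
    proof (clarify)
      fix i
      have j: "0 \<le> j $ i" "j $ i \<le> int k - 1" and u: "0 \<le> u $ i" "u $ i < int m"
        using j u by (auto simp: lattice_box_def C_def)
      have "int (m + r) * (j $ i) \<le> int (m + r) * (int k - 1)" using j by (intro mult_left_mono) auto
      also have "\<dots> = int (k * (m + r)) - int (m + r)" by (simp add: algebra_simps)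
      also have "int (k * (m + r)) \<le> int n" using kn by (simp only: of_nat_le_iff)
      finally have "int (m + r) * (j $ i) \<le> int n - int (m + r)" by simp
      moreover have "0 \<le> int (m + r) * (j $ i)" using j by simp
      ultimately show "0 \<le> x $ i \<and> x $ i < int n" using u by (simp add: x tile_shift_def)
    qed
  qed
  have cardU: "card ?U = k ^ CARD('d) * m ^ CARD('d)"
  proof -
    have "card ?U = (\<Sum>j\<in>lattice_box k. card (?T j))"
      by (rule card_UN_disjoint) (simp_all add: finC disj_T)
    then show ?thesis by (simp add: cardC card_lattice_box)
  qed
  have cardR: "real (card ?R) = real n ^ CARD('d) - real k ^ CARD('d) * real m ^ CARD('d)"
  proof -
    have "card ?R = card (lattice_box n :: 'd lattice set) - card ?U"
      by (rule card_Diff_subset[OF _ sub]) (simp add: finC)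
    moreover have "card ?U \<le> card (lattice_box n :: 'd lattice set)"
      by (rule card_mono[OF _ sub]) simp
    ultimately have "real (card ?R) = real (n ^ CARD('d)) - real (k ^ CARD('d) * m ^ CARD('d))"
      unfolding cardU card_lattice_box by (simp only: of_nat_diff)
    then show ?thesis by simp
  qed
  \<comment> \<open>The partition consists of the tiles and of the single points outside all tiles. Splitting the rest
    into points makes its contribution proportional to its cardinality.\<close>
  have "\<bar>f (\<Union>(?Q1 \<union> ?Q2)) \<omega> E - (\<Sum>Q\<in>?Q1 \<union> ?Q2. f Q \<omega> E)\<bar> \<le> (\<Sum>Q\<in>?Q1 \<union> ?Q2. b Q)"
  proof (rule partition_estimate[OF \<omega>])
    show "?Q1 \<union> ?Q2 \<noteq> {}" using imageI[OF zero_in_lattice_box[OF k], of ?T] by (metis UnI1 empty_iff)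
    show "disjoint (?Q1 \<union> ?Q2)"
    proof (rule disjoint_union)
      show "disjoint ?Q1"
      proof (rule disjointI)
        fix P Q assume "P \<in> ?Q1" "Q \<in> ?Q1" "P \<noteq> Q"
        then obtain i j where ij: "P = ?T i" "Q = ?T j" "i \<noteq> j" by blast
        show "P \<inter> Q = {}" unfolding ij by (rule disj_T[OF ij(3)])
      qed
      show "disjoint ?Q2" by (rule disjointI) blast
      have "\<Union>?Q2 = ?R" by (rule UN_singleton)
      then show "\<Union>?Q1 \<inter> \<Union>?Q2 = {}" by (simp only: Diff_disjoint)
    qed
    show "finite (?Q1 \<union> ?Q2)" by simp
    show "finite Q" if "Q \<in> ?Q1 \<union> ?Q2" for Q using that finC by (elim UnE imageE) simp_all
  qed
  moreover have "\<Union>(?Q1 \<union> ?Q2) = lattice_box n" unfolding Union_Un_distrib UN_singleton using sub by (rule Un_Diff_cancel[THEN trans, OF sup.absorb2])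
  moreover have "(\<Sum>Q\<in>?Q1 \<union> ?Q2. g Q) = (\<Sum>j\<in>lattice_box k. g (?T j)) + (\<Sum>x\<in>?R. g {x})" for g :: "_ \<Rightarrow> real"
  proof -
    have "?Q1 \<inter> ?Q2 = {}"
    proof (rule ccontr)
      assume "?Q1 \<inter> ?Q2 \<noteq> {}"
      then obtain Q where "Q \<in> ?Q1" "Q \<in> ?Q2" by blast
      then obtain j x where "j \<in> lattice_box k" "x \<in> ?R" "?T j = {x}" by (elim imageE) simp
      then have "x \<in> ?T j" by simp
      with \<open>j \<in> lattice_box k\<close> have "x \<in> ?U" by (rule UN_I)
      with \<open>x \<in> ?R\<close> show False by simp
    qed
    then have "(\<Sum>Q\<in>?Q1 \<union> ?Q2. g Q) = (\<Sum>Q\<in>?Q1. g Q) + (\<Sum>Q\<in>?Q2. g Q)"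
      by (intro sum.union_disjoint) auto
    also have "(\<Sum>Q\<in>?Q1. g Q) = (\<Sum>j\<in>lattice_box k. g (?T j))" by (simp add: sum.reindex[OF inj])
    also have "(\<Sum>Q\<in>?Q2. g Q) = (\<Sum>x\<in>?R. g {x})" by (subst sum.reindex) simp_all
    finally show ?thesis .
  qed
  ultimately have "\<bar>f (lattice_box n) \<omega> E - ((\<Sum>j\<in>lattice_box k. f (?T j) \<omega> E) + (\<Sum>x\<in>?R. f {x} \<omega> E))\<bar>
      \<le> (\<Sum>j\<in>lattice_box k. b (?T j)) + (\<Sum>x\<in>?R. b {x})" by (simp only:)
  moreover have "(\<Sum>j\<in>lattice_box k. f (?T j) \<omega> E) = S"
    unfolding S_def by (simp add: covariant[OF finC \<omega>])
  moreover have "(\<Sum>j\<in>lattice_box k. b (?T j)) = real k ^ CARD('d) * b C"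
    by (simp add: b_translate[OF finC] card_lattice_box)
  moreover have "(\<Sum>x\<in>?R. b {x}) \<le> (\<Sum>x\<in>?R. D)"
    by (rule sum_mono) (use b_le[of "{x}" for x] in simp)
  moreover have "\<bar>\<Sum>x\<in>?R. f {x} \<omega> E\<bar> \<le> (\<Sum>x\<in>?R. K)"
    by (rule order_trans[OF sum_abs sum_mono]) (rule point_bound[OF \<omega>])
  moreover have "(\<Sum>x\<in>?R. D) + (\<Sum>x\<in>?R. K) = (D + K) * real (card ?R)" by (simp add: algebra_simps)
  ultimately show ?thesis unfolding cardR by linarith
qed

text \<open>
  The sum over the tiles is normalised here by the volume of the tiles and not by that of the box.
  The difference is again bounded by the relative volume outside the tiles, which explains the factor \<open>2\<close>.
\<close>

lemma tiling_average_estimate: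
  fixes E :: real
  assumes \<omega>: "\<omega> \<in> configs A" and m: "0 < m" and k: "0 < k" and kn: "k * (m + r) \<le> n"
  defines "C \<equiv> lattice_box m :: 'd lattice set"
  defines "S \<equiv> \<Sum>j\<in>lattice_box k. f C (shift_config (tile_shift (m + r) j) \<omega>) E"
  shows "\<bar>f (lattice_box n) \<omega> E / real n ^ CARD('d) - S / (real k ^ CARD('d) * real m ^ CARD('d))\<bar>
      \<le> b C / real m ^ CARD('d) + 2 * (D + K) * (1 - (real k * real m / real n) ^ CARD('d))"
proof -
  define N where "N = real n ^ CARD('d)"
  define k' where "k' = real k ^ CARD('d)"
  define m' where "m' = real m ^ CARD('d)"
  have km: "k * m \<le> n" using kn by (simp add: algebra_simps)
  have n: "0 < n" using km k m by (cases n) auto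
  have pos: "0 < N" "0 < k'" "0 < m'" using n k m by (simp_all add: N_def k'_def m'_def)
  have "k' * m' \<le> N" unfolding N_def k'_def m'_def
    using km by (subst power_mult_distrib[symmetric], intro power_mono) (simp_all flip: of_nat_mult)
  then have le1: "k' * m' / N \<le> 1" using pos by simp
  have ratio: "(real k * real m / real n) ^ CARD('d) = k' * m' / N"
    by (simp add: power_divide power_mult_distrib N_def k'_def m'_def)
  have b0: "0 \<le> b C" by (rule b_nonneg) (simp add: C_def)
  let ?L = "D + K"
  have L: "0 < ?L" using D_pos K_nonneg by simp
  have est: "\<bar>f (lattice_box n) \<omega> E - S\<bar> \<le> k' * b C + ?L * (N - k' * m')"
    unfolding S_def C_def N_def k'_def m'_def by (rule tiling_sum_estimate[OF \<omega> m k kn])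
  have "\<bar>S\<bar> \<le> (\<Sum>j\<in>(lattice_box k :: 'd lattice set). ?L * real (card C))"
    unfolding S_def
    by (rule order_trans[OF sum_abs sum_mono], rule volume_bound[OF shift_config_in_configs[OF \<omega>]])
       (use zero_in_lattice_box[OF m] in \<open>auto simp: C_def\<close>)
  then have S: "\<bar>S\<bar> \<le> k' * m' * ?L" by (simp add: C_def card_lattice_box k'_def m'_def algebra_simps)
  define \<rho> where "\<rho> = 1 - k' * m' / N"
  have \<rho>: "0 \<le> \<rho>" using le1 by (simp add: \<rho>_def)
  have split: "f (lattice_box n) \<omega> E / N - S / (k' * m')
      = (f (lattice_box n) \<omega> E - S) / N - S / (k' * m') * \<rho>"
    using pos by (simp add: \<rho>_def field_simps)
  have "\<bar>(f (lattice_box n) \<omega> E - S) / N\<bar> \<le> (k' * b C + ?L * (N - k' * m')) / N"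
    using est pos by (simp add: abs_divide divide_right_mono)
  also have "\<dots> = (k' * m' / N) * (b C / m') + ?L * \<rho>"
    using pos by (simp add: \<rho>_def field_simps)
  finally have first: "\<bar>(f (lattice_box n) \<omega> E - S) / N\<bar> \<le> (k' * m' / N) * (b C / m') + ?L * \<rho>" .
  have tile: "(k' * m' / N) * (b C / m') \<le> b C / m'"
    using le1 b0 pos by (intro mult_left_le_one_le) simp_all
  have "\<bar>S / (k' * m')\<bar> \<le> ?L" using S pos by (simp add: abs_divide pos_divide_le_eq mult.commute)
  then have "\<bar>S / (k' * m')\<bar> * \<bar>\<rho>\<bar> \<le> ?L * \<bar>\<rho>\<bar>" by (rule mult_right_mono) simp
  then have second: "\<bar>S / (k' * m') * \<rho>\<bar> \<le> ?L * \<rho>" using \<rho> by (simp only: abs_mult abs_of_nonneg)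
  have "\<bar>f (lattice_box n) \<omega> E / N - S / (k' * m')\<bar> \<le> b C / m' + 2 * (?L * \<rho>)"
    using first tile second unfolding split by linarith
  then show ?thesis unfolding ratio \<rho>_def N_def[symmetric] k'_def[symmetric] m'_def[symmetric]
    by (simp only: mult.assoc)
qed

end

section \<open>Convergence of the normalised functions\<close>

text \<open>
  As \<open>n\<close> grows the tiles fill a fraction \<open>(m / q)^d\<close> of the box, where \<open>q\<close> is the period.
\<close>

lemma tile_volume_fraction_tendsto:
  fixes L :: real and q m d :: nat
  assumes q: "0 < q"
  shows "(\<lambda>n. L * (1 - (real (n div q) * real m / real n) ^ d)) \<longlonglongrightarrow> L * (1 - (real m / real q) ^ d)"
proof -
  have "(\<lambda>n. real (n div q) / real n) \<longlonglongrightarrow> 1 / real q"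
  proof (rule tendsto_sandwich[of "\<lambda>n. 1 / real q - 1 / real n" _ _ "\<lambda>_. 1 / real q"])
    have *: "1 / real q - 1 / real n \<le> real (n div q) / real n \<and> real (n div q) / real n \<le> 1 / real q"
      if n: "0 < n" for n
    proof -
      have "n = q * (n div q) + n mod q" "n mod q < q" using q by simp_all
      then have "real n = real q * real (n div q) + real (n mod q)" "real (n mod q) < real q"
        by (metis of_nat_add of_nat_mult, simp only: of_nat_less_iff)
      then have "real q * real (n div q) \<le> real n" "real n \<le> real q * real (n div q) + real q"
        by (simp_all del: of_nat_mult)
      then have k: "real (n div q) \<le> real n / real q" "(real n - real q) / real q \<le> real (n div q)"
        using q by (simp_all add: pos_le_divide_eq pos_divide_le_eq mult.commute)
      have "1 / real q - 1 / real n = (real n - real q) / real q / real n"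
        using n q by (simp add: diff_divide_distrib)
      also have "\<dots> \<le> real (n div q) / real n" using k(2) by (rule divide_right_mono) simp
      finally have "1 / real q - 1 / real n \<le> real (n div q) / real n" .
      moreover have "real (n div q) / real n \<le> real n / real q / real n"
        using k(1) by (rule divide_right_mono) simp
      moreover have "real n / real q / real n = 1 / real q" using n by simp
      ultimately show ?thesis by simp
    qed
    show "\<forall>\<^sub>F n in sequentially. 1 / real q - 1 / real n \<le> real (n div q) / real n"
      using eventually_gt_at_top[of 0] by eventually_elim (use * in blast)
    show "\<forall>\<^sub>F n in sequentially. real (n div q) / real n \<le> 1 / real q"
      using eventually_gt_at_top[of 0] by eventually_elim (use * in blast)
    show "(\<lambda>n. 1 / real q - 1 / real n) \<longlonglongrightarrow> 1 / real q"
      using tendsto_diff[OF tendsto_const lim_1_over_n, of "1 / real q"] by simp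
  qed (rule tendsto_const)
  from tendsto_mult[OF this tendsto_const[of "real m"]]
  have "(\<lambda>n. real (n div q) * real m / real n) \<longlonglongrightarrow> real m / real q" by simp
  then show ?thesis by (intro tendsto_mult tendsto_diff tendsto_power tendsto_const)
qed

text \<open>
  As the side of the tiles grows, corridors of fixed width \<open>r\<close> take up a vanishing fraction.
\<close>

lemma side_fraction_tendsto:
  fixes L :: real and r d :: nat
  shows "(\<lambda>i. L * (1 - (real (Suc i) / real (Suc i + r)) ^ d)) \<longlonglongrightarrow> 0"
proof -
  have "(\<lambda>i. real r / real (Suc i)) \<longlonglongrightarrow> 0" by (rule LIMSEQ_Suc) (rule lim_const_over_n)
  then have "(\<lambda>i. inverse (1 + real r / real (Suc i))) \<longlonglongrightarrow> inverse (1 + 0)"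
    by (intro tendsto_intros) simp_all
  moreover have "inverse (1 + real r / real (Suc i)) = real (Suc i) / real (Suc i + r)" for i
    by (simp add: field_simps)
  ultimately have "(\<lambda>i. real (Suc i) / real (Suc i + r)) \<longlonglongrightarrow> 1" by (simp only: add_0_right inverse_1)
  then have "(\<lambda>i. L * (1 - (real (Suc i) / real (Suc i + r)) ^ d)) \<longlonglongrightarrow> L * (1 - 1 ^ d)"
    by (intro tendsto_mult tendsto_diff tendsto_power tendsto_const)
  then show ?thesis by simp
qed

text \<open>
  For a tile of side \<open>m\<close> the functions \<open>x \<mapsto> f(x)(E)\<close> on tile patterns are, up to an affine change,
  monotone functions with values in \<open>[0, 1]\<close>, for all \<open>E\<close> simultaneously. Their averages over the tiles
  therefore converge uniformly in \<open>E\<close>, and these averages approximate \<open>f\<close> on large boxes.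
\<close>

lemma (in almost_additive_function) uniform_approximation:
  fixes P :: "('d lattice \<Rightarrow> real) measure" and s :: "'d lattice \<Rightarrow> int"
  assumes P: "prob_space P" and sets: "sets P = sets (config_space A UNIV)"
    and M1: "M1 A P" and M2: "M2 A P \<mu>" and M3: "M3 A P \<mu> r"
    and local: "\<And>\<Lambda>. finite \<Lambda> \<Longrightarrow> \<forall>\<omega>\<in>configs A. \<forall>\<omega>'\<in>configs A. restrict \<omega> \<Lambda> = restrict \<omega>' \<Lambda> \<longrightarrow> f \<Lambda> \<omega> = f \<Lambda> \<omega>'"
    and mono: "coordinatewise_monotone A f s" and \<epsilon>: "0 < \<epsilon>"
  shows "\<exists>c. AE \<omega> in P. \<forall>\<^sub>F n in sequentially. \<forall>E.
    \<bar>f (lattice_box n) \<omega> E / real (card (lattice_box n :: 'd lattice set)) - c E\<bar> \<le> \<epsilon>"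
proof -
  interpret prob_space P by (rule P)
  define L where "L = D + K"
  have L: "0 < L" using D_pos K_nonneg by (simp add: L_def)
  have space_P: "space P = configs A" by (rule sets_eq_imp_space_eq[OF sets])
  obtain a where a: "a \<in> A"
  proof -
    obtain \<omega> :: "'d lattice \<Rightarrow> real" where "\<omega> \<in> configs A" using not_empty space_P by auto
    then have "\<omega> 0 \<in> A" by (simp add: configs_iff)
    then show thesis by (rule that)
  qed
  \<comment> \<open>The tile side is chosen first: it makes the boundary term and the corridors of width \<open>r\<close> negligible.\<close>
  have \<epsilon>4: "0 < \<epsilon> / 4" using \<epsilon> by simp
  obtain m where m: "0 < m" "b (lattice_box m) / real m ^ CARD('d) < \<epsilon> / 4"
    "2 * L * (1 - (real m / real (m + r)) ^ CARD('d)) < \<epsilon> / 4"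
  proof -
    have "(\<lambda>i. b (lattice_box (Suc i)) / real (card (lattice_box (Suc i) :: 'd lattice set))) \<longlonglongrightarrow> 0"
    proof (rule additive[unfolded almost_additive_def, THEN conjunct2, THEN conjunct2, THEN conjunct2, THEN conjunct2,
          THEN spec, THEN spec, THEN mp, THEN mp])
      show "strict_mono Suc" by (simp add: strict_mono_def)
      show "\<forall>i. is_cube (Suc i) (lattice_box (Suc i) :: 'd lattice set)"
        unfolding is_cube_def translate_def by (intro allI exI[of _ 0]) simp
    qed
    then have "\<forall>\<^sub>F i in sequentially. b (lattice_box (Suc i)) / real (card (lattice_box (Suc i) :: 'd lattice set)) < \<epsilon> / 4"
      by (rule order_tendstoD(2)) (rule \<epsilon>4)
    moreover have "\<forall>\<^sub>F i in sequentially. 2 * L * (1 - (real (Suc i) / real (Suc i + r)) ^ CARD('d)) < \<epsilon> / 4"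
      by (rule order_tendstoD(2)[OF side_fraction_tendsto \<epsilon>4])
    ultimately have "\<forall>\<^sub>F i in sequentially. b (lattice_box (Suc i)) / real (card (lattice_box (Suc i) :: 'd lattice set)) < \<epsilon> / 4 \<and>
        2 * L * (1 - (real (Suc i) / real (Suc i + r)) ^ CARD('d)) < \<epsilon> / 4" by (rule eventually_conj)
    then obtain i where "b (lattice_box (Suc i)) / real (card (lattice_box (Suc i) :: 'd lattice set)) < \<epsilon> / 4"
        "2 * L * (1 - (real (Suc i) / real (Suc i + r)) ^ CARD('d)) < \<epsilon> / 4"
      using eventually_happens'[OF sequentially_bot] by blast
    then show thesis by (intro that[of "Suc i"]) (simp_all only: card_lattice_box of_nat_power zero_less_Suc)
  qed
  let ?C = "lattice_box m :: 'd lattice set"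
  define M where "M = real m ^ CARD('d)"
  have M: "0 < M" using m(1) by (simp add: M_def)
  have cardC: "real (card ?C) = M" by (simp add: card_lattice_box M_def)
  \<comment> \<open>A tile pattern is extended by a constant colour; by locality the values outside the tile are irrelevant.\<close>
  define ext where "ext x = (\<lambda>z. if z \<in> ?C then x z else a)" for x :: "'d lattice \<Rightarrow> real"
  have ext: "ext x \<in> configs A" if "x \<in> ?C \<rightarrow>\<^sub>E A" for x
    using that a by (auto simp: configs_iff ext_def PiE_iff)
  have f_ext: "f ?C (ext (restrict \<omega> ?C)) = f ?C \<omega>" if "\<omega> \<in> configs A" for \<omega>
  proof (rule local[OF finite_lattice_box, rule_format])
    show "ext (restrict \<omega> ?C) \<in> configs A" using that a by (auto simp: configs_iff ext_def)
    show "restrict (ext (restrict \<omega> ?C)) ?C = restrict \<omega> ?C" by (auto simp: fun_eq_iff ext_def)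
  qed (rule that)
  \<comment> \<open>Affine normalisation to \<open>[0, 1]\<close>, possible since \<open>f\<close> is bounded by \<open>L\<close> times the volume.\<close>
  define g where "g E x = (f ?C (ext x) E + L * M) / (2 * L * M)" for E x
  have g: "g E \<in> signed_monotone A (\<lambda>z. real_of_int (s z)) ?C" for E
  proof (rule signed_monotoneI)
    fix x assume x: "x \<in> ?C \<rightarrow>\<^sub>E A"
    have "\<bar>f ?C (ext x) E\<bar> \<le> L * M" unfolding L_def cardC[symmetric]
      by (rule volume_bound[OF ext[OF x]]) (use zero_in_lattice_box[OF m(1)] in auto)
    then show "0 \<le> g E x" "g E x \<le> 1" using L M by (auto simp: g_def pos_divide_le_eq)
    fix y assume y: "y \<in> ?C \<rightarrow>\<^sub>E A" and le: "\<forall>z\<in>?C. real_of_int (s z) * x z \<le> real_of_int (s z) * y z"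
    have "f ?C (ext x) E \<le> f ?C (ext y) E"
      by (rule configs_monotone[OF mono local[OF finite_lattice_box] finite_lattice_box ext[OF x] ext[OF y]])
         (use le in \<open>simp add: ext_def\<close>)
    then show "g E x \<le> g E y" unfolding g_def using L M by (intro divide_right_mono) simp_all
  qed
  have s1: "real_of_int (s z) = 1 \<or> real_of_int (s z) = -1" for z
  proof -
    have "s z = -1 \<or> s z = 1"
      using mono[unfolded coordinatewise_monotone_def, THEN conjunct1, THEN spec, of z] by simp
    then show ?thesis by (elim disjE) simp_all
  qed
  have close: "\<bar>x - z\<bar> \<le> \<epsilon>" if "\<bar>x - y\<bar> \<le> \<epsilon> / 4 + \<epsilon> / 4" "\<bar>y - z\<bar> \<le> \<epsilon> / 4" for x y z :: real
    using that \<epsilon> by linarith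
  let ?q = "m + r"
  define avg where "avg k \<omega> E = (\<Sum>j\<in>lattice_box k. g E (restrict (shift_config (tile_shift ?q j) \<omega>) ?C))
       / real (card (lattice_box k :: 'd lattice set))" for k \<omega> E
  \<comment> \<open>Undoing the normalisation of \<open>g\<close> multiplies errors by \<open>2 * L\<close>, which leaves \<open>\<epsilon> / 4\<close>.\<close>
  have \<epsilon>': "0 < \<epsilon> / (8 * L)" using \<epsilon> L by simp
  from tile_Glivenko_Cantelli[OF P sets M1 M2 M3 m(1) s1 this] obtain c where
    c: "AE \<omega> in P. \<forall>\<^sub>F k in sequentially. \<forall>h\<in>signed_monotone A (\<lambda>z. real_of_int (s z)) ?C.
      \<bar>(\<Sum>j\<in>lattice_box k. h (restrict (shift_config (tile_shift ?q j) \<omega>) ?C))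
        / real (card (lattice_box k :: 'd lattice set)) - c h\<bar> \<le> \<epsilon> / (8 * L)" by (rule exE)
  show ?thesis
  proof (intro exI[of _ "\<lambda>E. 2 * L * c (g E) - L"], rule AE_mp[OF c], intro AE_I2 impI)
    fix \<omega> assume "\<omega> \<in> space P"
    then have \<omega>: "\<omega> \<in> configs A" by (simp add: space_P)
    assume "\<forall>\<^sub>F k in sequentially. \<forall>h\<in>signed_monotone A (\<lambda>z. real_of_int (s z)) ?C.
      \<bar>(\<Sum>j\<in>lattice_box k. h (restrict (shift_config (tile_shift ?q j) \<omega>) ?C))
        / real (card (lattice_box k :: 'd lattice set)) - c h\<bar> \<le> \<epsilon> / (8 * L)"
    then have "\<forall>\<^sub>F k in sequentially. 0 < k \<and> (\<forall>E. \<bar>avg k \<omega> E - c (g E)\<bar> \<le> \<epsilon> / (8 * L))"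
      using eventually_gt_at_top[of 0]
    proof eventually_elim
      case (elim k)
      show ?case unfolding avg_def using elim(2) bspec[OF elim(1) g] by blast
    qed
    then have ev1: "\<forall>\<^sub>F n in sequentially. 0 < n div ?q \<and> (\<forall>E. \<bar>avg (n div ?q) \<omega> E - c (g E)\<bar> \<le> \<epsilon> / (8 * L))"
      by (rule eventually_compose_filterlim) (rule filterlim_at_top_div_const_nat, use m(1) in simp)
    have "\<forall>\<^sub>F n in sequentially. 2 * L * (1 - (real (n div ?q) * real m / real n) ^ CARD('d)) < \<epsilon> / 4"
      by (rule order_tendstoD(2)[OF tile_volume_fraction_tendsto m(3)]) (use m(1) in simp)
    with ev1 show "\<forall>\<^sub>F n in sequentially. \<forall>E.
      \<bar>f (lattice_box n) \<omega> E / real (card (lattice_box n :: 'd lattice set)) - (2 * L * c (g E) - L)\<bar> \<le> \<epsilon>"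
    proof eventually_elim
      case (elim n)
      define k where "k = n div ?q"
      define k' where "k' = real k ^ CARD('d)"
      have k: "0 < k" "k * ?q \<le> n" using elim(1) by (simp_all add: k_def)
      have k': "0 < k'" using k(1) by (simp add: k'_def)
      show ?case
      proof
        fix E
        define S where "S = (\<Sum>j\<in>(lattice_box k :: 'd lattice set). f ?C (shift_config (tile_shift ?q j) \<omega>) E)"
        have "\<bar>f (lattice_box n) \<omega> E / real n ^ CARD('d) - S / (k' * M)\<bar>
            \<le> b ?C / real m ^ CARD('d) + 2 * (D + K) * (1 - (real k * real m / real n) ^ CARD('d))"
          unfolding S_def k'_def M_def by (rule tiling_average_estimate[OF \<omega> m(1) k])
        then have est: "\<bar>f (lattice_box n) \<omega> E / real n ^ CARD('d) - S / (k' * M)\<bar> \<le> \<epsilon> / 4 + \<epsilon> / 4"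
          using m(2) elim(2) unfolding L_def k_def by linarith
        have "(\<Sum>j\<in>(lattice_box k :: 'd lattice set). g E (restrict (shift_config (tile_shift ?q j) \<omega>) ?C))
            = (\<Sum>j\<in>(lattice_box k :: 'd lattice set). (f ?C (shift_config (tile_shift ?q j) \<omega>) E + L * M) / (2 * L * M))"
          by (simp only: g_def f_ext[OF shift_config_in_configs[OF \<omega>]])
        also have "\<dots> = (S + k' * (L * M)) / (2 * L * M)"
          by (simp add: sum_divide_distrib[symmetric] sum.distrib S_def card_lattice_box k'_def)
        finally have "avg k \<omega> E = (S + k' * (L * M)) / (2 * L * M) / k'"
          by (simp add: avg_def card_lattice_box k'_def)
        then have S: "S / (k' * M) = 2 * L * avg k \<omega> E - L"
          using k' M L by (simp add: field_simps)
        have "\<bar>avg k \<omega> E - c (g E)\<bar> \<le> \<epsilon> / (8 * L)" using elim(1) unfolding k_def by blast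
        then have "2 * L * \<bar>avg k \<omega> E - c (g E)\<bar> \<le> 2 * L * (\<epsilon> / (8 * L))"
          using L by (intro mult_left_mono) simp_all
        also have "\<dots> = \<epsilon> / 4" using L by simp
        also have "2 * L * \<bar>avg k \<omega> E - c (g E)\<bar> = \<bar>2 * L * (avg k \<omega> E - c (g E))\<bar>"
          using L by (simp add: abs_mult)
        also have "2 * L * (avg k \<omega> E - c (g E)) = S / (k' * M) - (2 * L * c (g E) - L)"
          unfolding S by (simp add: algebra_simps)
        finally have "\<bar>S / (k' * M) - (2 * L * c (g E) - L)\<bar> \<le> \<epsilon> / 4" .
        then have "\<bar>f (lattice_box n) \<omega> E / real n ^ CARD('d) - (2 * L * c (g E) - L)\<bar> \<le> \<epsilon>"
          by (rule close[OF est])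
        then show "\<bar>f (lattice_box n) \<omega> E / real (card (lattice_box n :: 'd lattice set)) - (2 * L * c (g E) - L)\<bar> \<le> \<epsilon>"
          by (simp add: card_lattice_box)
      qed
    qed
  qed
qed

lemma rc_bounded_divide:
  assumes "F \<in> rc_bounded"
  shows "(\<lambda>E. F E / c) \<in> rc_bounded"
proof -
  have "bounded (range F)" and rc: "\<And>E. continuous (at_right E) F" using assms by (simp_all add: rc_bounded_def)
  then have "bounded ((\<lambda>y. (1 / c) *\<^sub>R y) ` range F)" by (intro bounded_scaling)
  moreover have "(\<lambda>y. (1 / c) *\<^sub>R y) ` range F = range (\<lambda>E. F E / c)" by (simp add: image_image)
  moreover have "continuous (at_right E) (\<lambda>E. F E * (1 / c))" for E
    by (intro continuous_mult continuous_const rc)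
  ultimately show ?thesis by (simp add: rc_bounded_def)
qed

theorem theorem2p6:
  fixes A :: "real set"
    and P :: "(int ^ 'd::finite \<Rightarrow> real) measure"
    and r :: nat
    and f :: "(int ^ 'd) set \<Rightarrow> (int ^ 'd \<Rightarrow> real) \<Rightarrow> real \<Rightarrow> real"
  assumes "prob_space P"
    and "sets P = sets (config_space A UNIV)"
    and "M1 A P"
    and "\<exists>\<mu>. M2 A P \<mu> \<and> M3 A P \<mu> r"
    and "admissible A f"
  shows "\<exists>\<Omega>'\<in>sets (config_space A UNIV). measure P \<Omega>' = 1 \<and>
           (\<exists>fstar\<in>rc_bounded. \<forall>\<omega>\<in>\<Omega>'.
              (\<lambda>n. sup_norm (\<lambda>E. f (lattice_box n) \<omega> E / real (card (lattice_box n :: (int ^ 'd) set)) - fstar E))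
                \<longlonglongrightarrow> 0)"
proof -
  note adm = assms(5)[unfolded admissible_def]
  note rc = adm[THEN conjunct1, rule_format]
  note covariant = adm[THEN conjunct2, THEN conjunct1, rule_format]
  note local = adm[THEN conjunct2, THEN conjunct2, THEN conjunct1, THEN spec, THEN mp]
  note rest = adm[THEN conjunct2, THEN conjunct2, THEN conjunct2]
  obtain b where b: "almost_additive A f b" using rest[THEN conjunct1] by (rule exE)
  obtain s where s: "coordinatewise_monotone A f s" using rest[THEN conjunct2, THEN conjunct1] by (rule exE)
  obtain K where K0: "\<forall>y\<in>(\<lambda>\<omega>. sup_norm (f {0} \<omega>)) ` configs A. y \<le> K"
    using rest[THEN conjunct2, THEN conjunct2] unfolding bdd_above_def by (rule exE)
  have K: "sup_norm (f {0} \<omega>) \<le> max 0 K" if "\<omega> \<in> configs A" for \<omega>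
    using bspec[OF K0 imageI[OF that]] by simp
  obtain D where D0: "0 < D \<and> (\<forall>\<Lambda>. finite \<Lambda> \<longrightarrow> b \<Lambda> \<le> D * real (card \<Lambda>))"
    using b[unfolded almost_additive_def, THEN conjunct2, THEN conjunct2, THEN conjunct2, THEN conjunct1] by (rule exE)
  note D = D0[THEN conjunct1] D0[THEN conjunct2, rule_format]
  obtain \<mu> where \<mu>: "M2 A P \<mu>" "M3 A P \<mu> r" using assms(4) by blast
  interpret almost_additive_function A f b D "max 0 K"
    by unfold_locales (fact rc, fact covariant, fact b, fact D(2), fact K, fact D(1), simp)
  have space_P: "space P = configs A" by (rule sets_eq_imp_space_eq[OF assms(2)])
  have "\<exists>\<Omega>'\<in>sets P. measure P \<Omega>' = 1 \<and>
    (\<exists>g\<in>rc_bounded. \<forall>\<omega>\<in>\<Omega>'. (\<lambda>n. sup_norm (\<lambda>E.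
       f (lattice_box n) \<omega> E / real (card (lattice_box n :: (int ^ 'd) set)) - g E)) \<longlonglongrightarrow> 0)"
  proof (rule deterministic_uniform_limit[OF assms(1)])
    show "\<exists>c. AE \<omega> in P. \<forall>\<^sub>F n in sequentially. \<forall>E.
      \<bar>f (lattice_box n) \<omega> E / real (card (lattice_box n :: (int ^ 'd) set)) - c E\<bar> \<le> \<epsilon>" if "0 < \<epsilon>" for \<epsilon>
      by (rule uniform_approximation[OF assms(1-3) \<mu> local s that])
    show "(\<lambda>E. f (lattice_box n) \<omega> E / real (card (lattice_box n :: (int ^ 'd) set))) \<in> rc_bounded"
      if "\<omega> \<in> space P" for n \<omega>
      by (rule rc_bounded_divide) (use rc that space_P in simp)
  qed
  then show ?thesis using assms(2) by simp
qed

end
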